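(* Let $T$ be a finite set, and for each $S\subset T$ let $J_S(x,dz_S)$ be a bounded nonnegative kernel from $E^T$ to $E^S$. Consider the generator $$\mathcal{L}f(x):=\sum_{S\subset T}\int_{E^S}J_S(x,dz_S)\,[f(x^{z_S})-f(x)].$$ Assume that for each $S\subset T$ and every $j\in T$ there is a finite optimal (i.e. smallest) constant $c_S(j)\ge0$ such that $$\sup_{x=y\text{ off }j,\ x_j\neq y_j}\frac{1}{d(x_j,y_j)}\left|\int_{E^S}g(z_S)\,\big(J_S(x,dz_S)-J_S(y,dz_S)\big)\right|\le c_S(j)\sum_{i\in S}\delta_i(g)$$ for all $g\in C_{\mathrm{Lip}}(E^S)$. Let $$c_{ij}:=\sum_{S\ni i}c_S(j),\quad C:=(c_{ij})_{i,j\in T},\qquad \eta:=\inf_{x\in E^T}\inf_{i\in T}\sum_{S\ni i}J_S(x,E^S).$$ Then $P_t=e^{t\mathcal{L}}$, $t\ge 0$, is a Markov semigroup on the space of bounded measurable functions on $E^T$, mapping $C_{\mathrm{Lip}}(E^T)$ into itself, such that for any $f\in C_{\mathrm{Lip}}(E^T)$ and $t\ge0$, $$\delta_j(P_tf)\le\sum_{i\in T}\delta_i(f)\,(e^{-t(\eta I-C)})_{ij}\qquad\forall j\in T,$$ where $I$ is the identity matrix.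
   Context: $(E,\mathcal{B},d)$ is either a complete separable metric space with its Borel $\sigma$-field $\mathcal{B}$, or a measurable space $(E,\mathcal{B})$ with the trivial metric $d(x,y)=\mathbb{1}_{x\ne y}$, assumed $\mathcal{B}\times\mathcal{B}$-measurable. Products $E^S$ carry the product $\sigma$-field. For $x\in E^T$ and $z_S\in E^S$, $x^{z_S}\in E^T$ is the configuration equal to $z_i$ at $i\in S$ and to $x_i$ at $i\notin S$. For a finite set $S$ and a real function $f$ on $E^S$, $\delta_i(f):=\sup\{|f(y)-f(x)|/d(y_i,x_i):\ x=y\text{ off }i,\ x_i\ne y_i\}$ for $i\in S$, and $C_{\mathrm{Lip}}(E^S)$ is the set of bounded measurable $f:E^S\to\mathbb{R}$ with $\sup_{i\in S}\delta_i(f)<+\infty$. "Bounded kernel" means $\sup_xJ_S(x,E^S)<\infty$. *)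

theory Defs
  imports "HOL-Probability.Probability"
begin

text \<open>
  The measure \<open>M\<close> only serves to carry the measurable space \<open>(E, \<B>) = (space M, sets M)\<close>.
\<close>

definition polish_setting :: "'a measure \<Rightarrow> ('a \<Rightarrow> 'a \<Rightarrow> real) \<Rightarrow> bool" where
  "polish_setting M d \<longleftrightarrow>
     Metric_space (space M) d \<and>
     Metric_space.mcomplete (space M) d \<and>
     separable_space (Metric_space.mtopology (space M) d) \<and>
     sets M = sigma_sets (space M) {U. openin (Metric_space.mtopology (space M) d) U}"

definition trivial_metric_setting :: "'a measure \<Rightarrow> ('a \<Rightarrow> 'a \<Rightarrow> real) \<Rightarrow> bool" where
  "trivial_metric_setting M d \<longleftrightarrow>
     (\<forall>x\<in>space M. \<forall>y\<in>space M. d x y = (if x = y then 0 else 1)) \<and>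
     (\<lambda>(x, y). d x y) \<in> borel_measurable (M \<Otimes>\<^sub>M M)"

abbreviation config :: "'a measure \<Rightarrow> 'i set \<Rightarrow> ('i \<Rightarrow> 'a) measure" where
  "config M S \<equiv> PiM S (\<lambda>_. M)"

definition splice :: "'i set \<Rightarrow> 'i set \<Rightarrow> ('i \<Rightarrow> 'a) \<Rightarrow> ('i \<Rightarrow> 'a) \<Rightarrow> ('i \<Rightarrow> 'a)" where
  "splice T S x z = (\<lambda>i\<in>T. if i \<in> S then z i else x i)"

text \<open>
  The Lipschitz coefficients are suprema in \<open>[0, \<infinity>]\<close>; inserting \<open>0\<close> fixes the supremum over
  the empty family, which occurs when \<open>E\<close> has at most one point.
\<close>

definition delta ::
  "'a measure \<Rightarrow> ('a \<Rightarrow> 'a \<Rightarrow> real) \<Rightarrow> 'i set \<Rightarrow> 'i \<Rightarrow> (('i \<Rightarrow> 'a) \<Rightarrow> real) \<Rightarrow> ereal" where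
  "delta M d S i f = Sup (insert 0
     {ereal (\<bar>f y - f x\<bar> / d (y i) (x i)) | x y.
        x \<in> space (config M S) \<and> y \<in> space (config M S) \<and>
        (\<forall>k\<in>S. k \<noteq> i \<longrightarrow> x k = y k) \<and> x i \<noteq> y i})"

definition bounded_measurable :: "'b measure \<Rightarrow> ('b \<Rightarrow> real) set" where
  "bounded_measurable N = {f \<in> borel_measurable N. bounded (f ` space N)}"

definition C_Lip ::
  "'a measure \<Rightarrow> ('a \<Rightarrow> 'a \<Rightarrow> real) \<Rightarrow> 'i set \<Rightarrow> (('i \<Rightarrow> 'a) \<Rightarrow> real) set" where
  "C_Lip M d S = {f \<in> bounded_measurable (config M S). (SUP i\<in>S. delta M d S i f) < \<infinity>}"

definition bounded_kernel :: "'b measure \<Rightarrow> 'c measure \<Rightarrow> ('b \<Rightarrow> 'c measure) \<Rightarrow> bool" where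
  "bounded_kernel A B K \<longleftrightarrow>
     (\<forall>x\<in>space A. sets (K x) = sets B) \<and>
     (\<forall>Z\<in>sets B. (\<lambda>x. emeasure (K x) Z) \<in> borel_measurable A) \<and>
     (SUP x\<in>space A. emeasure (K x) (space B)) < \<infinity>"

definition generator ::
  "'i set \<Rightarrow> ('i set \<Rightarrow> ('i \<Rightarrow> 'a) \<Rightarrow> ('i \<Rightarrow> 'a) measure) \<Rightarrow>
   (('i \<Rightarrow> 'a) \<Rightarrow> real) \<Rightarrow> ('i \<Rightarrow> 'a) \<Rightarrow> real" where
  "generator T J f x = (\<Sum>S\<in>Pow T. \<integral>z. (f (splice T S x z) - f x) \<partial>(J S x))"

text \<open>
  The supremum over \<open>x = y\<close> off \<open>j\<close>, \<open>x j \<noteq> y j\<close>, of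
  \<open>\<bar>\<integral>g d(K x - K y)\<bar> / d (x j) (y j)\<close> is the coefficient \<open>delta\<close> at \<open>j\<close> of \<open>x \<mapsto> \<integral>g d(K x)\<close>.
\<close>

definition admissible_const ::
  "'a measure \<Rightarrow> ('a \<Rightarrow> 'a \<Rightarrow> real) \<Rightarrow> 'i set \<Rightarrow> 'i set \<Rightarrow>
   (('i \<Rightarrow> 'a) \<Rightarrow> ('i \<Rightarrow> 'a) measure) \<Rightarrow> 'i \<Rightarrow> real \<Rightarrow> bool" where
  "admissible_const M d T S K j k \<longleftrightarrow>
     0 \<le> k \<and>
     (\<forall>g\<in>C_Lip M d S.
        delta M d T j (\<lambda>x. \<integral>z. g z \<partial>(K x)) \<le> ereal k * (\<Sum>i\<in>S. delta M d S i g))"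

definition optimal_const ::
  "'a measure \<Rightarrow> ('a \<Rightarrow> 'a \<Rightarrow> real) \<Rightarrow> 'i set \<Rightarrow> 'i set \<Rightarrow>
   (('i \<Rightarrow> 'a) \<Rightarrow> ('i \<Rightarrow> 'a) measure) \<Rightarrow> 'i \<Rightarrow> real \<Rightarrow> bool" where
  "optimal_const M d T S K j k \<longleftrightarrow>
     admissible_const M d T S K j k \<and> (\<forall>k'. admissible_const M d T S K j k' \<longrightarrow> k \<le> k')"

definition interaction :: "'i set \<Rightarrow> ('i set \<Rightarrow> 'i \<Rightarrow> real) \<Rightarrow> 'i \<Rightarrow> 'i \<Rightarrow> real" where
  "interaction T c i j = (\<Sum>S | S \<subseteq> T \<and> i \<in> S. c S j)"

definition min_rate ::
  "'a measure \<Rightarrow> 'i set \<Rightarrow> ('i set \<Rightarrow> ('i \<Rightarrow> 'a) \<Rightarrow> ('i \<Rightarrow> 'a) measure) \<Rightarrow> real" where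
  "min_rate M T J =
     (INF x\<in>space (config M T). INF i\<in>T.
        \<Sum>S | S \<subseteq> T \<and> i \<in> S. measure (J S x) (space (config M S)))"

text \<open>Matrices indexed by \<open>T\<close> are functions; only entries with both indices in \<open>T\<close> matter.\<close>

definition mat_id :: "'i \<Rightarrow> 'i \<Rightarrow> real" where
  "mat_id i j = (if i = j then 1 else 0)"

definition mat_mult :: "'i set \<Rightarrow> ('i \<Rightarrow> 'i \<Rightarrow> real) \<Rightarrow> ('i \<Rightarrow> 'i \<Rightarrow> real) \<Rightarrow> 'i \<Rightarrow> 'i \<Rightarrow> real" where
  "mat_mult T A B i j = (\<Sum>k\<in>T. A i k * B k j)"

definition mat_exp :: "'i set \<Rightarrow> ('i \<Rightarrow> 'i \<Rightarrow> real) \<Rightarrow> 'i \<Rightarrow> 'i \<Rightarrow> real" where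
  "mat_exp T A i j = (\<Sum>n. ((mat_mult T A ^^ n) mat_id) i j / fact n)"

definition op_exp_partial ::
  "(('b \<Rightarrow> real) \<Rightarrow> 'b \<Rightarrow> real) \<Rightarrow> real \<Rightarrow> ('b \<Rightarrow> real) \<Rightarrow> nat \<Rightarrow> 'b \<Rightarrow> real" where
  "op_exp_partial L t f N x = (\<Sum>n<N. t ^ n / fact n * (L ^^ n) f x)"

definition op_exp ::
  "(('b \<Rightarrow> real) \<Rightarrow> 'b \<Rightarrow> real) \<Rightarrow> real \<Rightarrow> ('b \<Rightarrow> real) \<Rightarrow> 'b \<Rightarrow> real" where
  "op_exp L t f x = (\<Sum>n. t ^ n / fact n * (L ^^ n) f x)"

text \<open>
  A Markov semigroup on the bounded measurable functions: each \<open>P t\<close> acts by a probability kernel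
  (so it is linear, positive and preserves the constant \<open>1\<close>), the semigroup law holds, and
  \<open>t \<mapsto> P t f\<close> is continuous in the supremum norm.
\<close>

definition markov_semigroup ::
  "'b measure \<Rightarrow> (real \<Rightarrow> ('b \<Rightarrow> real) \<Rightarrow> 'b \<Rightarrow> real) \<Rightarrow> bool" where
  "markov_semigroup N P \<longleftrightarrow>
     (\<forall>t\<ge>0. \<forall>f\<in>bounded_measurable N. P t f \<in> bounded_measurable N) \<and>
     (\<forall>t\<ge>0. \<exists>K. K \<in> N \<rightarrow>\<^sub>M prob_algebra N \<and>
        (\<forall>f\<in>bounded_measurable N. \<forall>x\<in>space N. P t f x = (\<integral>y. f y \<partial>(K x)))) \<and>
     (\<forall>f\<in>bounded_measurable N. \<forall>x\<in>space N. P 0 f x = f x) \<and>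
     (\<forall>s\<ge>0. \<forall>t\<ge>0. \<forall>f\<in>bounded_measurable N. \<forall>x\<in>space N. P (s + t) f x = P s (P t f) x) \<and>
     (\<forall>s\<ge>0. \<forall>f\<in>bounded_measurable N.
        uniform_limit (space N) (\<lambda>t. P t f) (P s f) (at s within {0..}))"

end

theory Submission
  imports Defs
begin

text \<open>
  The proof is by uniformization. Let \<open>\<Lambda>\<close> bound the total jump rate. Then \<open>Q = I + \<L> / \<Lambda>\<close> is a
  Markov operator and \<open>P\<^sub>t = exp (- \<Lambda> t) \<Sum>\<^sub>n (\<Lambda> t)^n / n! Q^n\<close> is a Poisson mixture of its powers.
  Comparing the jumps from two configurations which differ only at \<open>j\<close> gives
  \<open>\<delta>\<^sub>j (Q f) \<le> \<Sum>\<^sub>i \<delta>\<^sub>i f B\<^sub>i\<^sub>j\<close> with the nonnegative matrix \<open>B = I + (C - \<eta> I) / \<Lambda>\<close>, hence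
  \<open>\<delta> (Q^n f) \<le> \<delta> f B^n\<close>. Summing the Poisson series and using the uniformization identity for
  matrices in the opposite direction yields the factor \<open>exp (t (C - \<eta> I))\<close>.
\<close>

section \<open>Exponential series\<close>

text \<open>The shift by \<Lambda> is dictated by signs. Estimating the exponential series of the
  generator term by term sees only absolute values and would turn the decay rate \<eta> into growth.
  Likewise C - \<eta> I may have negative diagonal entries, so multiplying by it need not preserve
  inequalities between vectors of Lipschitz bounds. After the shift all weights are nonnegative on
  both sides, and two series can be compared term by term; \<Lambda> cancels from the result, so any
  positive bound on the total rate serves. The same shift exhibits \<open>P_t\<close> as a
  probability kernel, which the exponential series of the generator does not show.

  The identity exp (q (Q - I)) = exp (- q) exp (q Q) is needed once for functions on configurations
  and once for vectors indexed by \<open>T\<close>; hence an abstract treatment of bounded operators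
  serves both. Functions are total while norms only see the points of a set \<open>X\<close>, so all
  operator identities are stated pointwise on \<open>X\<close> and reduce to real series.\<close>

lemma exp_series_sums: "(\<lambda>n. (x::real) ^ n / fact n) sums exp x"
  using exp_converges[of x] by (simp add: field_simps)

lemma exp_series_summable: "summable (\<lambda>n. (x::real) ^ n / fact n)"
  using exp_series_sums by (rule sums_summable)

text \<open>In the applications \<open>a k\<close> is the value at one point of the
  \<open>k\<close>-th iterate of an operator of norm at most \<open>D\<close>, so geometric growth
  is the natural hypothesis.\<close>

lemma exp_moments_term_le:
  fixes a :: "nat \<Rightarrow> real"
  assumes "\<And>k. \<bar>a k\<bar> \<le> D ^ k * B"
  shows "\<bar>t ^ n / fact n * a n\<bar> \<le> B * ((\<bar>t\<bar> * D) ^ n / fact n)"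
proof -
  have "\<bar>t ^ n / fact n * a n\<bar> = \<bar>t\<bar> ^ n / fact n * \<bar>a n\<bar>"
    by (simp add: abs_mult power_abs)
  also have "\<dots> \<le> \<bar>t\<bar> ^ n / fact n * (D ^ n * B)"
    by (intro mult_left_mono assms) auto
  finally show ?thesis
    by (simp add: power_mult_distrib mult_ac)
qed

lemma exp_moments_summable:
  fixes a :: "nat \<Rightarrow> real"
  assumes "\<And>k. \<bar>a k\<bar> \<le> D ^ k * B"
  shows "summable (\<lambda>n. norm (t ^ n / fact n * a n))"
proof (rule summable_comparison_test')
  show "summable (\<lambda>n. B * ((\<bar>t\<bar> * D) ^ n / fact n))"
    by (intro summable_mult exp_series_summable)
  show "norm (norm (t ^ n / fact n * a n)) \<le> B * ((\<bar>t\<bar> * D) ^ n / fact n)" for n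
    using exp_moments_term_le[OF assms, of t n] by simp
qed

text \<open>The scalar core of the semigroup law: the double series over \<open>(n, m)\<close>
  converges absolutely, so it may be summed along rows or along the diagonals
  \<open>n + m = k\<close>.\<close>

lemma exp_moments_add:
  fixes a :: "nat \<Rightarrow> real"
  assumes D: "0 \<le> D" and a: "\<And>k. \<bar>a k\<bar> \<le> D ^ k * B"
  shows "(\<Sum>n. s ^ n / fact n * (\<Sum>m. t ^ m / fact m * a (n + m))) =
    (\<Sum>k. (s + t) ^ k / fact k * a k)"
proof -
  define h where "h = (\<lambda>(n, m). s ^ n / fact n * (t ^ m / fact m * a (n + m)))"
  have shift: "\<bar>a (n + k)\<bar> \<le> D ^ k * (D ^ n * B)" for n k
    using a[of "n + k"] by (simp add: power_add mult_ac)
  \<comment> \<open>The majorizing double series has entries that factor; \<open>g n\<close> is the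
    sum of its row \<open>n\<close>.\<close>
  define g where "g = (\<lambda>n. B * ((\<bar>s\<bar> * D) ^ n / fact n) * exp (\<bar>t\<bar> * D))"
  have B: "0 \<le> B" using a[of 0] by simp
  have "(\<lambda>(n, m). B * ((\<bar>s\<bar> * D) ^ n / fact n) * ((\<bar>t\<bar> * D) ^ m / fact m))
    summable_on Sigma UNIV (\<lambda>_. UNIV)"
  proof (rule summable_on_SigmaI[where g = g])
    show "g summable_on UNIV"
      unfolding g_def using B D summable_mult2[OF summable_mult[OF exp_series_summable]]
      by (intro norm_summable_imp_summable_on) (simp add: abs_mult power_abs)
    show "((\<lambda>m. case (n, m) of (n, m) \<Rightarrow>
        B * ((\<bar>s\<bar> * D) ^ n / fact n) * ((\<bar>t\<bar> * D) ^ m / fact m)) has_sum g n) UNIV" for n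
      unfolding g_def prod.case
      using B D summable_mult[OF exp_series_summable, of "B * ((\<bar>s\<bar> * D) ^ n / fact n)" "\<bar>t\<bar> * D"]
      by (intro norm_summable_imp_has_sum sums_mult exp_series_sums) (simp add: abs_mult power_abs)
  qed (use B D in auto)
  then have "(\<lambda>z. norm (h z)) summable_on Sigma UNIV (\<lambda>_. UNIV)"
  proof (rule Infinite_Sum.abs_summable_on_comparison_test', clarify)
    fix n m :: nat
    have "norm (h (n, m)) = \<bar>s\<bar> ^ n / fact n * \<bar>t ^ m / fact m * a (n + m)\<bar>"
      by (simp add: h_def abs_mult power_abs)
    also have "\<dots> \<le> \<bar>s\<bar> ^ n / fact n * ((D ^ n * B) * ((\<bar>t\<bar> * D) ^ m / fact m))"
      by (intro mult_left_mono exp_moments_term_le shift) auto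
    finally show "norm (h (n, m)) \<le> B * ((\<bar>s\<bar> * D) ^ n / fact n) * ((\<bar>t\<bar> * D) ^ m / fact m)"
      by (simp add: power_mult_distrib mult_ac)
  qed
  then have summable: "h summable_on Sigma UNIV (\<lambda>_. UNIV)"
    by (rule Infinite_Sum.abs_summable_summable)
  have row: "((\<lambda>m. h (n, m)) has_sum (s ^ n / fact n * (\<Sum>m. t ^ m / fact m * a (n + m)))) UNIV" for n
    unfolding h_def prod.case
    by (intro has_sum_cmult_right norm_summable_imp_has_sum summable_sums
          exp_moments_summable[OF shift] summable_norm_cancel[OF exp_moments_summable[OF shift]])
  have "(h has_sum infsum h (Sigma UNIV (\<lambda>_. UNIV))) (Sigma UNIV (\<lambda>_. UNIV))"
    using summable by (rule has_sum_infsum)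
  from has_sum_imp_sums[OF has_sum_SigmaD[OF this row]]
  have 1: "(\<Sum>n. s ^ n / fact n * (\<Sum>m. t ^ m / fact m * a (n + m))) = infsum h (UNIV \<times> UNIV)"
    by (simp add: sums_iff)
  \<comment> \<open>Regrouping by diagonals: \<open>k\<close> is the sum of both indices and
    \<open>i\<close> the first of them.\<close>
  have bij: "bij_betw (\<lambda>(k, i). (i, k - i)) (Sigma UNIV (\<lambda>k. {..k})) (UNIV \<times> (UNIV :: nat set))"
    by (rule bij_betwI[where g = "\<lambda>(n, m). (n + m, n)"]) auto
  let ?h' = "\<lambda>z. h (case z of (k, i) \<Rightarrow> (i, k - i))"
  have "?h' summable_on Sigma UNIV (\<lambda>k. {..k})"
    using summable summable_on_reindex_bij_betw[OF bij, of h] by simp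
  then have "(?h' has_sum infsum ?h' (Sigma UNIV (\<lambda>k. {..k}))) (Sigma UNIV (\<lambda>k. {..k}))"
    by (rule has_sum_infsum)
  then have h': "(?h' has_sum infsum h (UNIV \<times> UNIV)) (Sigma UNIV (\<lambda>k. {..k}))"
    unfolding infsum_reindex_bij_betw[OF bij, of h] .
  \<comment> \<open>The factor \<open>a k\<close> is constant on a diagonal, so the binomial theorem
    sums the rest.\<close>
  have diagonal: "((\<lambda>i. ?h' (k, i)) has_sum ((s + t) ^ k / fact k * a k)) {..k}" for k
  proof -
    have "(\<Sum>i\<le>k. ?h' (k, i)) = (\<Sum>i\<le>k. of_nat (k choose i) * s ^ i * t ^ (k - i) / fact k * a k)"
      by (intro sum.cong) (auto simp: h_def binomial_fact field_simps)
    also have "\<dots> = (s + t) ^ k / fact k * a k"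
      by (simp add: binomial_ring sum_distrib_right sum_divide_distrib)
    finally show ?thesis by (simp add: has_sum_finite_iff)
  qed
  from has_sum_imp_sums[OF has_sum_SigmaD[OF h' diagonal]]
  have "(\<Sum>k. (s + t) ^ k / fact k * a k) = infsum h (UNIV \<times> UNIV)"
    by (simp add: sums_iff)
  with 1 show ?thesis by simp
qed

text \<open>The binomial expansion of \<open>(q Q - q I)^n\<close> at one point, with
  \<open>u n k\<close> standing for \<open>(L ^^ n) ((Q ^^ k) f) x\<close>. Division by
  \<open>fact n\<close> brings it into the form of a Cauchy product of two exponential series. The
  second index is carried because the recursion shifts it.\<close>

lemma difference_recursion_solution:
  fixes u :: "nat \<Rightarrow> nat \<Rightarrow> real"
  assumes "\<And>n k. u (Suc n) k = q * (u n (Suc k) - u n k)"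
  shows "u n k / fact n = (\<Sum>i\<le>n. q ^ i / fact i * u 0 (k + i) * ((- q) ^ (n - i) / fact (n - i)))"
proof -
  have "u n k = (\<Sum>i\<le>n. of_nat (n choose i) * q ^ i * (- q) ^ (n - i) * u 0 (k + i))"
  proof (induction n arbitrary: k)
    case 0
    then show ?case by simp
  next
    case (Suc n)
    let ?c = "\<lambda>n i. of_nat (n choose i) * q ^ i * (- q) ^ (n - i) :: real"
    \<comment> \<open>Pascal's rule. At \<open>i = n\<close> the last term vanishes through its
      binomial coefficient, so the truncated exponent \<open>n - Suc n\<close> does no harm.\<close>
    have pascal: "?c (Suc n) (Suc i) = q * ?c n i - q * ?c n (Suc i)" if "i \<le> n" for i
    proof (cases "i < n")
      case True
      then have "n - i = Suc (n - Suc i)" by simp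
      with True show ?thesis by (simp add: algebra_simps)
    next
      case False
      with that show ?thesis by (simp add: algebra_simps)
    qed
    have shift: "(\<Sum>i\<le>n. ?c n (Suc i) * u 0 (k + Suc i)) = (\<Sum>i\<le>n. ?c n i * u 0 (k + i)) - ?c n 0 * u 0 k"
      using sum.atMost_Suc_shift[of "\<lambda>i. ?c n i * u 0 (k + i)" n]
      by (simp add: binomial_eq_0)
    have "(\<Sum>i\<le>Suc n. ?c (Suc n) i * u 0 (k + i)) =
      ?c (Suc n) 0 * u 0 k + (\<Sum>i\<le>n. ?c (Suc n) (Suc i) * u 0 (Suc k + i))"
      by (subst sum.atMost_Suc_shift) simp
    also have "(\<Sum>i\<le>n. ?c (Suc n) (Suc i) * u 0 (Suc k + i)) =
      (\<Sum>i\<le>n. q * (?c n i * u 0 (Suc k + i)) - q * (?c n (Suc i) * u 0 (k + Suc i)))"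
      by (intro sum.cong refl, simp only: pascal atMost_iff) (simp add: left_diff_distrib mult.assoc)
    also have "\<dots> = q * (\<Sum>i\<le>n. ?c n i * u 0 (Suc k + i)) -
      q * ((\<Sum>i\<le>n. ?c n i * u 0 (k + i)) - ?c n 0 * u 0 k)"
      by (simp only: sum_subtractf sum_distrib_left[symmetric] shift)
    finally have "(\<Sum>i\<le>Suc n. ?c (Suc n) i * u 0 (k + i)) = q * (u n (Suc k) - u n k)"
      unfolding Suc.IH[of k] Suc.IH[of "Suc k"] by (simp add: algebra_simps)
    with assms[of n k] show ?case by simp
  qed
  also have "\<dots> = fact n * (\<Sum>i\<le>n. q ^ i / fact i * u 0 (k + i) * ((- q) ^ (n - i) / fact (n - i)))"
    unfolding sum_distrib_left by (intro sum.cong) (auto simp: binomial_fact field_simps)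
  finally show ?thesis by simp
qed

section \<open>Exponentials of bounded operators\<close>

text \<open>Two instances are intended: bounded measurable functions on a configuration space, and
  arbitrary vectors over the finite index set. Closure under uniform limits on \<open>X\<close> also
  makes membership in \<open>V\<close> insensitive to values off \<open>X\<close>.\<close>

locale function_space =
  fixes X :: "'b set" and V :: "('b \<Rightarrow> real) set"
  assumes bounded_member: "g \<in> V \<Longrightarrow> bounded (g ` X)"
    and linear_combination: "g \<in> V \<Longrightarrow> h \<in> V \<Longrightarrow> (\<lambda>x. a * g x + b * h x) \<in> V"
    and uniform_limit_member: "(\<And>n. G n \<in> V) \<Longrightarrow> uniform_limit X G h sequentially \<Longrightarrow> h \<in> V"
begin

lemma obtain_bound:
  assumes "g \<in> V"
  obtains B where "0 \<le> B" "\<And>x. x \<in> X \<Longrightarrow> \<bar>g x\<bar> \<le> B"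
proof -
  obtain B where "\<forall>y\<in>g ` X. norm y \<le> B"
    using bounded_member[OF assms] unfolding bounded_iff by blast
  then have "\<bar>g x\<bar> \<le> max B 0" if "x \<in> X" for x
    using that by (auto simp: max.coboundedI1)
  then show thesis by (intro that[of "max B 0"]) auto
qed

lemma diff_member: "g \<in> V \<Longrightarrow> h \<in> V \<Longrightarrow> (\<lambda>x. g x - h x) \<in> V"
  using linear_combination[of g h 1 "-1"] by simp

end

text \<open>\<open>op_bound\<close> speaks of an arbitrary bound \<open>B\<close> instead of a
  supremum norm, so it makes sense for every \<open>X\<close>, empty or not.\<close>

locale bounded_operator = function_space +
  fixes L :: "('b \<Rightarrow> real) \<Rightarrow> 'b \<Rightarrow> real" and D :: real
  assumes D_nonneg: "0 \<le> D"
    and op_member: "g \<in> V \<Longrightarrow> L g \<in> V"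
    and op_linear: "g \<in> V \<Longrightarrow> h \<in> V \<Longrightarrow> x \<in> X \<Longrightarrow>
      L (\<lambda>y. a * g y + b * h y) x = a * L g x + b * L h x"
    and op_bound: "g \<in> V \<Longrightarrow> (\<And>y. y \<in> X \<Longrightarrow> \<bar>g y\<bar> \<le> B) \<Longrightarrow> x \<in> X \<Longrightarrow> \<bar>L g x\<bar> \<le> D * B"
begin

lemma iterate_member: "g \<in> V \<Longrightarrow> (L ^^ n) g \<in> V"
  by (induction n) (auto intro: op_member)

lemma iterate_bound:
  assumes "g \<in> V" "\<And>y. y \<in> X \<Longrightarrow> \<bar>g y\<bar> \<le> B" "x \<in> X"
  shows "\<bar>(L ^^ n) g x\<bar> \<le> D ^ n * B"
  using assms(3)
proof (induction n arbitrary: x)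
  case 0
  then show ?case using assms(2) by simp
next
  case (Suc n)
  then show ?case
    using op_bound[OF iterate_member[OF assms(1)] Suc.IH] by (simp add: mult.assoc)
qed

text \<open>The operator might look at values off \<open>X\<close>; it does not, because a
  difference vanishing on \<open>X\<close> has bound 0 there and its image is then bounded by
  \<open>D * 0\<close>.\<close>

lemma op_cong:
  assumes "g \<in> V" "h \<in> V" "\<And>y. y \<in> X \<Longrightarrow> g y = h y" "x \<in> X"
  shows "L g x = L h x"
proof -
  have "L g x - L h x = L (\<lambda>y. 1 * g y + (-1) * h y) x"
    using op_linear[OF assms(1,2,4), of 1 "-1"] by simp
  moreover have "\<bar>L (\<lambda>y. 1 * g y + (-1) * h y) x\<bar> \<le> D * 0"
    by (rule op_bound[OF linear_combination]) (use assms in auto)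
  ultimately show ?thesis by simp
qed

lemma iterate_linear:
  assumes "g \<in> V" "h \<in> V" "x \<in> X"
  shows "(L ^^ n) (\<lambda>y. a * g y + b * h y) x = a * (L ^^ n) g x + b * (L ^^ n) h x"
  using assms(3)
proof (induction n arbitrary: x)
  case 0
  then show ?case by simp
next
  case (Suc n)
  have "L ((L ^^ n) (\<lambda>y. a * g y + b * h y)) x = L (\<lambda>y. a * (L ^^ n) g y + b * (L ^^ n) h y) x"
    by (rule op_cong) (use assms Suc in \<open>auto intro: iterate_member linear_combination\<close>)
  also have "\<dots> = a * L ((L ^^ n) g) x + b * L ((L ^^ n) h) x"
    by (rule op_linear) (use assms Suc in \<open>auto intro: iterate_member\<close>)
  finally show ?case by simp
qed

lemma iterate_cong:
  assumes "g \<in> V" "h \<in> V" "\<And>y. y \<in> X \<Longrightarrow> g y = h y" "x \<in> X"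
  shows "(L ^^ n) g x = (L ^^ n) h x"
  using assms(4)
proof (induction n arbitrary: x)
  case 0
  then show ?case using assms by simp
next
  case (Suc n)
  then show ?case using assms by (simp, intro op_cong iterate_member)
qed

lemma iterate_partial:
  assumes f: "f \<in> V" and x: "x \<in> X"
  shows "op_exp_partial L t f N \<in> V"
    and "(L ^^ n) (op_exp_partial L t f N) x = (\<Sum>m<N. t ^ m / fact m * (L ^^ (n + m)) f x)"
proof -
  have zero: "op_exp_partial L t f 0 = (\<lambda>x. 0 * f x + 0 * f x)"
    by (simp add: op_exp_partial_def fun_eq_iff)
  have Suc: "op_exp_partial L t f (Suc N) =
      (\<lambda>x. 1 * op_exp_partial L t f N x + t ^ N / fact N * (L ^^ N) f x)" for N
    by (simp add: op_exp_partial_def fun_eq_iff)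
  have mem: "op_exp_partial L t f N \<in> V" for N
  proof (induction N)
    case 0
    show ?case unfolding zero by (intro linear_combination f)
  next
    case (Suc N)
    then show ?case unfolding \<open>op_exp_partial L t f (Suc N) = _\<close>
      by (intro linear_combination iterate_member f)
  qed
  then show "op_exp_partial L t f N \<in> V" .
  show "(L ^^ n) (op_exp_partial L t f N) x = (\<Sum>m<N. t ^ m / fact m * (L ^^ (n + m)) f x)"
  proof (induction N)
    case 0
    show ?case unfolding zero by (subst iterate_linear[OF f f x]) simp
  next
    case (Suc N)
    then show ?case unfolding \<open>op_exp_partial L t f (Suc N) = _\<close>
      by (subst iterate_linear[OF mem iterate_member[OF f] x]) (simp add: funpow_add)
  qed
qed

lemma op_exp_summable:
  assumes "f \<in> V" "x \<in> X"
  shows "summable (\<lambda>m. norm (t ^ m / fact m * (L ^^ (n + m)) f x))"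
proof -
  obtain B where B: "\<And>x. x \<in> X \<Longrightarrow> \<bar>f x\<bar> \<le> B"
    using obtain_bound[OF assms(1)] by blast
  have "\<bar>(L ^^ (n + m)) f x\<bar> \<le> D ^ m * (D ^ n * B)" for m
    using iterate_bound[OF assms(1) B assms(2), of "n + m"] by (simp add: power_add mult_ac)
  then show ?thesis by (rule exp_moments_summable)
qed

lemma op_exp_sums:
  assumes "f \<in> V" "x \<in> X"
  shows "(\<lambda>n. t ^ n / fact n * (L ^^ n) f x) sums op_exp L t f x"
  unfolding op_exp_def
  by (rule summable_sums, rule summable_norm_cancel) (use op_exp_summable[OF assms, of t 0] in simp)

lemma uniform_limit_partial:
  assumes "f \<in> V"
  shows "uniform_limit X (op_exp_partial L t f) (op_exp L t f) sequentially"
proof -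
  obtain B where B: "\<And>x. x \<in> X \<Longrightarrow> \<bar>f x\<bar> \<le> B"
    using obtain_bound[OF assms] by blast
  have "uniform_limit X (\<lambda>N x. \<Sum>n<N. t ^ n / fact n * (L ^^ n) f x)
    (\<lambda>x. \<Sum>n. t ^ n / fact n * (L ^^ n) f x) sequentially"
  proof (rule Weierstrass_m_test)
    show "norm (t ^ n / fact n * (L ^^ n) f x) \<le> B * ((\<bar>t\<bar> * D) ^ n / fact n)" if "x \<in> X" for n x
      using exp_moments_term_le[OF iterate_bound[OF assms B that], where t=t] by simp
    show "summable (\<lambda>n. B * ((\<bar>t\<bar> * D) ^ n / fact n))"
      by (intro summable_mult exp_series_summable)
  qed
  then show ?thesis
    by (simp add: op_exp_partial_def[abs_def] op_exp_def[abs_def])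
qed

lemma op_exp_member:
  assumes "f \<in> V"
  shows "op_exp L t f \<in> V"
\<comment> \<open>\<open>iterate_partial\<close> is stated at a point of \<open>X\<close>. On an
  empty \<open>X\<close> any sequence converges uniformly to any function.\<close>
proof (cases "X = {}")
  case True
  then show ?thesis using uniform_limit_member[of "\<lambda>_. f" "op_exp L t f"] assms by simp
next
  case False
  then obtain x where "x \<in> X" by blast
  show ?thesis
    by (rule uniform_limit_member[OF iterate_partial(1)[OF assms \<open>x \<in> X\<close>] uniform_limit_partial[OF assms]])
qed

text \<open>\<open>L ^^ n\<close> passes through the infinite series because it is continuous for
  uniform convergence on \<open>X\<close>, with constant \<open>D ^ n\<close>.\<close>

lemma iterate_op_exp:
  assumes f: "f \<in> V" and x: "x \<in> X"
  shows "(L ^^ n) (op_exp L t f) x = (\<Sum>m. t ^ m / fact m * (L ^^ (n + m)) f x)"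
proof -
  note mem = iterate_partial(1)[OF f x] op_exp_member[OF f]
  have "(\<lambda>N. (L ^^ n) (op_exp_partial L t f N) x) \<longlonglongrightarrow> (L ^^ n) (op_exp L t f) x"
  proof (rule LIMSEQ_I)
    fix r :: real assume r: "0 < r"
    \<comment> \<open>Adding 1 keeps the denominator positive when \<open>D ^ n\<close> is
      0.\<close>
    define e where "e = r / (D ^ n + 1)"
    have pos: "0 < D ^ n + 1" using D_nonneg by (simp add: add_nonneg_pos)
    then have e: "0 < e" using r by (simp add: e_def)
    from uniform_limitD[OF uniform_limit_partial[OF f, of t] e]
    obtain N0 where N0: "\<And>N x. N \<ge> N0 \<Longrightarrow> x \<in> X \<Longrightarrow> \<bar>op_exp_partial L t f N x - op_exp L t f x\<bar> \<le> e"
      unfolding eventually_sequentially dist_real_def by (meson less_imp_le)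
    show "\<exists>N0. \<forall>N\<ge>N0. norm ((L ^^ n) (op_exp_partial L t f N) x - (L ^^ n) (op_exp L t f) x) < r"
    proof (intro exI allI impI)
      fix N assume "N \<ge> N0"
      have "(L ^^ n) (op_exp_partial L t f N) x - (L ^^ n) (op_exp L t f) x =
        (L ^^ n) (\<lambda>y. 1 * op_exp_partial L t f N y + (-1) * op_exp L t f y) x"
        by (subst iterate_linear[OF mem x]) simp
      also have "\<bar>\<dots>\<bar> \<le> D ^ n * e"
        by (rule iterate_bound[OF linear_combination[OF mem] _ x]) (use N0 \<open>N \<ge> N0\<close> in simp)
      also have "\<dots> < r"
        using r pos by (simp add: e_def field_simps)
      finally show "norm ((L ^^ n) (op_exp_partial L t f N) x - (L ^^ n) (op_exp L t f) x) < r"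
        by simp
    qed
  qed
  then have "(\<lambda>m. t ^ m / fact m * (L ^^ (n + m)) f x) sums (L ^^ n) (op_exp L t f) x"
    unfolding sums_def iterate_partial(2)[OF f x] .
  then show ?thesis by (rule sums_unique)
qed

theorem op_exp_add:
  assumes f: "f \<in> V" and x: "x \<in> X"
  shows "op_exp L (s + t) f x = op_exp L s (op_exp L t f) x"
proof -
  obtain B where B: "\<And>x. x \<in> X \<Longrightarrow> \<bar>f x\<bar> \<le> B"
    using obtain_bound[OF f] by blast
  have "op_exp L s (op_exp L t f) x =
      (\<Sum>n. s ^ n / fact n * (\<Sum>m. t ^ m / fact m * (L ^^ (n + m)) f x))"
    by (simp add: op_exp_def[of L s] iterate_op_exp[OF f x])
  also have "\<dots> = op_exp L (s + t) f x"
    unfolding op_exp_def by (rule exp_moments_add[OF D_nonneg iterate_bound[OF f B x]])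
  finally show ?thesis ..
qed

lemma op_exp_0: "op_exp L 0 f x = f x"
  using sums_unique[OF powser_sums_zero[of "\<lambda>n. (L ^^ n) f x / fact n"]]
  by (simp add: op_exp_def field_simps)

text \<open>Removing the zeroth term \<open>f x\<close> leaves a tail dominated by the exponential
  series without its leading 1, a bound that vanishes as \<open>t\<close> tends to 0.\<close>

lemma op_exp_diff_bound:
  assumes f: "f \<in> V" and B: "\<And>x. x \<in> X \<Longrightarrow> \<bar>f x\<bar> \<le> B" and x: "x \<in> X"
  shows "\<bar>op_exp L t f x - f x\<bar> \<le> B * (exp (\<bar>t\<bar> * D) - 1)"
proof -
  let ?a = "\<lambda>n. t ^ n / fact n * (L ^^ n) f x"
  let ?b = "\<lambda>n. B * ((\<bar>t\<bar> * D) ^ n / fact n)"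
  have le: "\<bar>?a n\<bar> \<le> ?b n" for n
    by (rule exp_moments_term_le[OF iterate_bound[OF f B x]])
  have a: "(\<lambda>n. ?a (Suc n)) sums (op_exp L t f x - f x)"
    using op_exp_sums[OF f x, of t] by (subst sums_Suc_iff) simp
  have b: "(\<lambda>n. ?b (Suc n)) sums (B * exp (\<bar>t\<bar> * D) - B)"
    using sums_mult[OF exp_series_sums, of B "\<bar>t\<bar> * D"] by (subst sums_Suc_iff) simp
  have "norm (\<Sum>n. ?a (Suc n)) \<le> (\<Sum>n. ?b (Suc n))"
    by (rule norm_suminf_le) (simp only: real_norm_def le, rule sums_summable[OF b])
  also have "\<dots> = B * exp (\<bar>t\<bar> * D) - B"
    using b by (rule sums_unique[symmetric])
  also have "(\<Sum>n. ?a (Suc n)) = op_exp L t f x - f x"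
    using a by (rule sums_unique[symmetric])
  finally show ?thesis by (simp add: right_diff_distrib)
qed

lemma uniform_limit_op_exp:
  assumes f: "f \<in> V"
  shows "uniform_limit X (\<lambda>t. op_exp L t f) (op_exp L s f) (at s within S)"
proof (rule uniform_limitI)
  fix e :: real assume "0 < e"
  obtain B where B: "0 \<le> B" "\<And>x. x \<in> X \<Longrightarrow> \<bar>op_exp L s f x\<bar> \<le> B"
    using obtain_bound[OF op_exp_member[OF f]] by blast
  have "((\<lambda>t. B * (exp (\<bar>t - s\<bar> * D) - 1)) \<longlongrightarrow> B * (exp (\<bar>s - s\<bar> * D) - 1)) (at s within S)"
    by (intro tendsto_intros)
  from tendstoD[OF this \<open>0 < e\<close>]
  have "\<forall>\<^sub>F t in at s within S. B * (exp (\<bar>t - s\<bar> * D) - 1) < e"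
    by (rule eventually_mono) (auto simp: dist_real_def)
  then show "\<forall>\<^sub>F t in at s within S. \<forall>x\<in>X. dist (op_exp L t f x) (op_exp L s f x) < e"
  proof (rule eventually_mono, intro ballI)
    fix t x assume *: "B * (exp (\<bar>t - s\<bar> * D) - 1) < e" and x: "x \<in> X"
    \<comment> \<open>Continuity at \<open>s\<close> is reduced to continuity at 0. The increment
      \<open>t - s\<close> may be negative; the addition law holds for all real times.\<close>
    have "op_exp L t f x = op_exp L (t - s) (op_exp L s f) x"
      using op_exp_add[OF f x, of "t - s" s] by simp
    with op_exp_diff_bound[OF op_exp_member[OF f] B(2) x, of "t - s"] *
    show "dist (op_exp L t f x) (op_exp L s f x) < e"
      by (simp add: dist_real_def)
  qed
qed

text \<open>\<open>Q\<close> commutes with the identity, so the exponential of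
  \<open>t q (Q - I)\<close> factors. The factorization is carried out at one point as a Cauchy
  product of real series.\<close>

theorem op_exp_uniformization:
  assumes Q: "bounded_operator X V Q D'"
    and L_eq: "\<And>g x. g \<in> V \<Longrightarrow> x \<in> X \<Longrightarrow> L g x = q * (Q g x - g x)"
    and f: "f \<in> V" and x: "x \<in> X"
  shows "op_exp L t f x = exp (- (q * t)) * op_exp Q (q * t) f x"
proof -
  interpret Q: bounded_operator X V Q D' by (rule Q)
  define u where "u n k = (L ^^ n) ((Q ^^ k) f) x" for n k
  have rec: "u (Suc n) k = q * (u n (Suc k) - u n k)" for n k
  proof -
    let ?g = "(Q ^^ k) f"
    have "u (Suc n) k = (L ^^ n) (L ?g) x"
      by (simp only: u_def funpow_Suc_right comp_apply)
    \<comment> \<open>\<open>L ?g\<close> agrees with this combination only on \<open>X\<close>, so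
      replacing it under \<open>L ^^ n\<close> rests on \<open>iterate_cong\<close>.\<close>
    also have "\<dots> = (L ^^ n) (\<lambda>y. q * Q ?g y + (- q) * ?g y) x"
      by (intro iterate_cong op_member Q.op_member linear_combination Q.iterate_member f x)
         (simp add: L_eq Q.iterate_member f right_diff_distrib)
    also have "\<dots> = q * (u n (Suc k) - u n k)"
      by (subst iterate_linear[OF Q.op_member[OF Q.iterate_member[OF f]] Q.iterate_member[OF f] x])
         (simp add: u_def right_diff_distrib)
    finally show ?thesis .
  qed
  have u: "u n 0 / fact n = (\<Sum>i\<le>n. q ^ i / fact i * u 0 i * ((- q) ^ (n - i) / fact (n - i)))" for n
    using difference_recursion_solution[of u q n 0] rec by simp
  have "t ^ n / fact n * (L ^^ n) f x =
    (\<Sum>i\<le>n. ((q * t) ^ i / fact i * (Q ^^ i) f x) * ((- (q * t)) ^ (n - i) / fact (n - i)))" for n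
  proof -
    have "t ^ n / fact n * (L ^^ n) f x = t ^ n * (u n 0 / fact n)"
      by (simp add: u_def)
    also have "\<dots> = (\<Sum>i\<le>n. t ^ n * (q ^ i / fact i * u 0 i * ((- q) ^ (n - i) / fact (n - i))))"
      unfolding u sum_distrib_left ..
    also have "\<dots> = (\<Sum>i\<le>n. ((q * t) ^ i / fact i * (Q ^^ i) f x) * ((- (q * t)) ^ (n - i) / fact (n - i)))"
    proof (rule sum.cong[OF refl])
      fix i assume "i \<in> {..n}"
      then have "t ^ n = t ^ i * t ^ (n - i)"
        by (simp flip: power_add)
      moreover have "(- (q * t)) ^ (n - i) = (- q) ^ (n - i) * t ^ (n - i)"
        by (simp flip: power_mult_distrib)
      ultimately show "t ^ n * (q ^ i / fact i * u 0 i * ((- q) ^ (n - i) / fact (n - i))) =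
        ((q * t) ^ i / fact i * (Q ^^ i) f x) * ((- (q * t)) ^ (n - i) / fact (n - i))"
        by (simp add: u_def power_mult_distrib mult_ac)
    qed
    finally show ?thesis .
  qed
  moreover have "(\<lambda>n. \<Sum>i\<le>n. ((q * t) ^ i / fact i * (Q ^^ i) f x) * ((- (q * t)) ^ (n - i) / fact (n - i)))
    sums ((\<Sum>i. (q * t) ^ i / fact i * (Q ^^ i) f x) * (\<Sum>k. (- (q * t)) ^ k / fact k))"
  proof (rule Cauchy_product_sums)
    show "summable (\<lambda>k. norm ((q * t) ^ k / fact k * (Q ^^ k) f x))"
      using Q.op_exp_summable[OF f x, of "q * t" 0] by simp
    show "summable (\<lambda>k. norm ((- (q * t)) ^ k / fact k))"
      using exp_series_summable[of "\<bar>q * t\<bar>"] by (simp add: power_abs)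
  qed
  moreover have "(\<Sum>k. (- (q * t)) ^ k / fact k) = exp (- (q * t))"
    by (rule sums_unique[OF exp_series_sums, symmetric])
  ultimately show ?thesis
    by (simp add: op_exp_def sums_iff mult.commute)
qed

end

section \<open>Markov operators\<close>

lemma bounded_measurableI:
  assumes "f \<in> borel_measurable N" "\<And>x. x \<in> space N \<Longrightarrow> \<bar>f x\<bar> \<le> B"
  shows "f \<in> bounded_measurable N"
  using assms by (auto simp: bounded_measurable_def intro!: boundedI[where B = B])

lemma bounded_measurableE:
  assumes "f \<in> bounded_measurable N"
  obtains B where "f \<in> borel_measurable N" "0 \<le> B" "\<And>x. x \<in> space N \<Longrightarrow> \<bar>f x\<bar> \<le> B"
proof -
  obtain B where "\<forall>y\<in>f ` space N. norm y \<le> B"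
    using assms unfolding bounded_measurable_def bounded_iff by blast
  then have "\<bar>f x\<bar> \<le> max B 0" if "x \<in> space N" for x
    using that by (auto simp: max.coboundedI1)
  with assms show thesis
    by (intro that[of "max B 0"]) (auto simp: bounded_measurable_def)
qed

lemma function_space_bounded_measurable: "function_space (space N) (bounded_measurable N)"
proof
  show "bounded (g ` space N)" if "g \<in> bounded_measurable N" for g
    using that by (simp add: bounded_measurable_def)
next
  fix g h :: "'a \<Rightarrow> real" and a b :: real
  assume "g \<in> bounded_measurable N" "h \<in> bounded_measurable N"
  then obtain A B where *: "g \<in> borel_measurable N" "h \<in> borel_measurable N"
    "\<And>x. x \<in> space N \<Longrightarrow> \<bar>g x\<bar> \<le> A" "\<And>x. x \<in> space N \<Longrightarrow> \<bar>h x\<bar> \<le> B"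
    by (metis bounded_measurableE)
  show "(\<lambda>x. a * g x + b * h x) \<in> bounded_measurable N"
  proof (rule bounded_measurableI[where B = "\<bar>a\<bar> * A + \<bar>b\<bar> * B"])
    show "(\<lambda>x. a * g x + b * h x) \<in> borel_measurable N" using *(1,2) by measurable
    fix x assume "x \<in> space N"
    then have "\<bar>a\<bar> * \<bar>g x\<bar> \<le> \<bar>a\<bar> * A" "\<bar>b\<bar> * \<bar>h x\<bar> \<le> \<bar>b\<bar> * B"
      using * by (auto intro: mult_left_mono)
    then show "\<bar>a * g x + b * h x\<bar> \<le> \<bar>a\<bar> * A + \<bar>b\<bar> * B"
      using abs_triangle_ineq[of "a * g x" "b * h x"] by (simp add: abs_mult)
  qed
next
  fix G h assume G: "\<And>n::nat. G n \<in> bounded_measurable N"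
    and lim: "uniform_limit (space N) G h sequentially"
  from uniform_limitD[OF lim zero_less_one]
  obtain n where n: "\<And>x. x \<in> space N \<Longrightarrow> dist (G n x) (h x) < 1"
    unfolding eventually_sequentially by blast
  from G[of n] obtain B where B: "\<And>x. x \<in> space N \<Longrightarrow> \<bar>G n x\<bar> \<le> B"
    by (metis bounded_measurableE)
  show "h \<in> bounded_measurable N"
  proof (rule bounded_measurableI)
    show "h \<in> borel_measurable N"
    proof (rule borel_measurable_LIMSEQ_real)
      show "(\<lambda>n. G n x) \<longlonglongrightarrow> h x" if "x \<in> space N" for x
        using lim that by (rule tendsto_uniform_limitI)
      show "G n \<in> borel_measurable N" for n
        using G[of n] by (simp add: bounded_measurable_def)
    qed
    show "\<bar>h x\<bar> \<le> B + 1" if "x \<in> space N" for x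
      using n[OF that] B[OF that] by (auto simp: dist_real_def)
  qed
qed

lemma (in finite_measure) integrable_bounded:
  fixes f :: "'a \<Rightarrow> real"
  assumes "f \<in> borel_measurable M" "\<And>x. x \<in> space M \<Longrightarrow> \<bar>f x\<bar> \<le> B"
  shows "integrable M f"
  using assms by (intro integrable_const_bound[where B = B]) auto

lemma (in finite_measure) abs_integral_le:
  fixes f :: "'a \<Rightarrow> real"
  assumes "f \<in> borel_measurable M" "\<And>x. x \<in> space M \<Longrightarrow> \<bar>f x\<bar> \<le> B"
  shows "\<bar>\<integral>x. f x \<partial>M\<bar> \<le> B * measure M (space M)"
proof -
  note f = integrable_bounded[OF assms]
  have "\<bar>\<integral>x. f x \<partial>M\<bar> \<le> (\<integral>x. \<bar>f x\<bar> \<partial>M)"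
    by (rule integral_abs_bound)
  also have "\<dots> \<le> (\<integral>x. B \<partial>M)"
    using f assms(2) by (intro integral_mono) auto
  finally show ?thesis by (simp add: mult.commute)
qed

text \<open>The kernel clause of \<open>markov_semigroup\<close> for a single operator, isolated
  because it is stable under composition and under mixing with probability weights.\<close>

definition markov_operator :: "'b measure \<Rightarrow> (('b \<Rightarrow> real) \<Rightarrow> 'b \<Rightarrow> real) \<Rightarrow> bool" where
  "markov_operator N Q \<longleftrightarrow> (\<exists>K. K \<in> N \<rightarrow>\<^sub>M prob_algebra N \<and>
     (\<forall>f\<in>bounded_measurable N. \<forall>x\<in>space N. Q f x = (\<integral>y. f y \<partial>(K x))))"

lemma markov_kernelD:
  assumes "K \<in> N \<rightarrow>\<^sub>M prob_algebra N" "x \<in> space N"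
  shows "prob_space (K x)" "sets (K x) = sets N" "space (K x) = space N"
  using measurable_space[OF assms] by (auto simp: space_prob_algebra dest: sets_eq_imp_space_eq)

lemma bounded_operator_markov:
  assumes "markov_operator N Q"
  shows "bounded_operator (space N) (bounded_measurable N) Q 1"
proof -
  interpret function_space "space N" "bounded_measurable N"
    by (rule function_space_bounded_measurable)
  obtain K where K[measurable]: "K \<in> N \<rightarrow>\<^sub>M prob_algebra N"
    and Q: "\<And>f x. f \<in> bounded_measurable N \<Longrightarrow> x \<in> space N \<Longrightarrow> Q f x = (\<integral>y. f y \<partial>(K x))"
    using assms unfolding markov_operator_def by blast
  note K_sub = measurable_prob_algebraD[OF K]
  have bound: "\<bar>Q g x\<bar> \<le> B"
    if g: "g \<in> bounded_measurable N" and B: "\<And>y. y \<in> space N \<Longrightarrow> \<bar>g y\<bar> \<le> B" and x: "x \<in> space N" for g B x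
  proof -
    interpret prob_space "K x" using K x by (rule markov_kernelD)
    have "g \<in> borel_measurable (K x)"
      using g markov_kernelD(2)[OF K x] by (simp add: bounded_measurable_def cong: measurable_cong_sets)
    from abs_integral_le[OF this, of B] show ?thesis
      using B markov_kernelD(3)[OF K x] prob_space by (simp add: Q[OF g x])
  qed
  show ?thesis
  proof
    show "Q g \<in> bounded_measurable N" if g: "g \<in> bounded_measurable N" for g
    proof -
      obtain B where B: "\<And>x. x \<in> space N \<Longrightarrow> \<bar>g x\<bar> \<le> B" and gm[measurable]: "g \<in> borel_measurable N"
        using bounded_measurableE[OF g] by blast
      show ?thesis
      proof (rule bounded_measurableI[OF _ bound[OF g B]])
        have "(\<lambda>x. \<integral>y. g y \<partial>(K x)) \<in> borel_measurable N"
          by (rule measurable_compose[OF K_sub integral_measurable_subprob_algebra]) measurable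
        then show "Q g \<in> borel_measurable N"
          by (subst measurable_cong[OF Q[OF g]])
      qed
    qed
    show "Q (\<lambda>y. a * g y + b * h y) x = a * Q g x + b * Q h x"
      if g: "g \<in> bounded_measurable N" and h: "h \<in> bounded_measurable N" and x: "x \<in> space N" for g h x a b
    proof -
      interpret prob_space "K x" using K x by (rule markov_kernelD)
      have "integrable (K x) g" if g: "g \<in> bounded_measurable N" for g
      proof -
        obtain B where "\<And>x. x \<in> space N \<Longrightarrow> \<bar>g x\<bar> \<le> B" "g \<in> borel_measurable N"
          using bounded_measurableE[OF g] by blast
        then show ?thesis using markov_kernelD(2,3)[OF K x]
          by (intro integrable_bounded[where B = B]) (auto cong: measurable_cong_sets)
      qed
      with g h show ?thesis
        by (simp add: Q[OF linear_combination] Q x)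
    qed
  qed (use bound in auto)
qed

section \<open>Composition and mixing of Markov kernels\<close>

text \<open>Chapman-Kolmogorov: the kernel \<open>K x \<bind> K'\<close> makes one step and then
  \<open>n\<close> more. The zeroth iterate has the Dirac kernel.\<close>

lemma markov_operator_iterate:
  assumes Q: "markov_operator N Q"
  shows "markov_operator N (Q ^^ n)"
proof (induction n)
  case 0
  have "return N \<in> N \<rightarrow>\<^sub>M prob_algebra N" by simp
  moreover have "f x = (\<integral>y. f y \<partial>return N x)" if "f \<in> bounded_measurable N" "x \<in> space N" for f x
    using that by (subst integral_return) (auto simp: bounded_measurable_def)
  ultimately show ?case unfolding markov_operator_def by (intro exI[of _ "return N"]) simp
next
  case (Suc n)
  obtain K where K: "K \<in> N \<rightarrow>\<^sub>M prob_algebra N"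
    and Q_eq: "\<And>f x. f \<in> bounded_measurable N \<Longrightarrow> x \<in> space N \<Longrightarrow> Q f x = (\<integral>y. f y \<partial>(K x))"
    using Q unfolding markov_operator_def by blast
  obtain K' where K': "K' \<in> N \<rightarrow>\<^sub>M prob_algebra N"
    and Qn_eq: "\<And>f x. f \<in> bounded_measurable N \<Longrightarrow> x \<in> space N \<Longrightarrow> (Q ^^ n) f x = (\<integral>y. f y \<partial>(K' x))"
    using Suc unfolding markov_operator_def by blast
  interpret Q: bounded_operator "space N" "bounded_measurable N" Q 1
    by (rule bounded_operator_markov[OF Q])
  have "(Q ^^ Suc n) f x = (\<integral>y. f y \<partial>(K x \<bind> K'))"
    if f: "f \<in> bounded_measurable N" and x: "x \<in> space N" for f x
  proof -
    interpret prob_space "K x" using K x by (rule markov_kernelD)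
    obtain B where B: "\<And>x. x \<in> space N \<Longrightarrow> \<bar>f x\<bar> \<le> B" "f \<in> borel_measurable N"
      using bounded_measurableE[OF f] by blast
    have "(\<integral>y. f y \<partial>(K x \<bind> K')) = (\<integral>y. (\<integral>z. f z \<partial>(K' y)) \<partial>(K x))"
    proof (rule integral_bind[where K = N and B = B and B' = 1])
      show "K' \<in> K x \<rightarrow>\<^sub>M subprob_algebra N"
        using measurable_prob_algebraD[OF K'] markov_kernelD(2)[OF K x] by (simp cong: measurable_cong_sets)
      show "AE y in K x. emeasure (K' y) (space (K' y)) \<le> ennreal 1"
        by (rule AE_I2) (simp add: markov_kernelD[OF K x] prob_space.emeasure_space_1[OF markov_kernelD(1)[OF K']])
    qed (use B in \<open>auto intro: finite_measure_axioms\<close>)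
    also have "\<dots> = (\<integral>y. (Q ^^ n) f y \<partial>(K x))"
      by (intro Bochner_Integration.integral_cong refl) (simp add: Qn_eq f markov_kernelD[OF K x])
    also have "\<dots> = Q ((Q ^^ n) f) x"
      by (rule Q_eq[symmetric]) (use f x Q.iterate_member in auto)
    finally show ?thesis by simp
  qed
  moreover have "(\<lambda>x. K x \<bind> K') \<in> N \<rightarrow>\<^sub>M prob_algebra N"
    using K K' by (rule measurable_bind_prob_space)
  ultimately show ?case unfolding markov_operator_def by blast
qed

lemma integral_poisson_pmf:
  fixes a :: "nat \<Rightarrow> real"
  assumes "0 < r" "summable (\<lambda>n. norm (r ^ n / fact n * a n))"
  shows "(\<integral>n. a n \<partial>measure_pmf (poisson_pmf r)) = exp (- r) * (\<Sum>n. r ^ n / fact n * a n)"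
proof -
  have "summable (\<lambda>n. exp (- r) * norm (r ^ n / fact n * a n))"
    using assms(2) by (rule summable_mult)
  then have summable: "summable (\<lambda>n. norm (r ^ n / fact n * exp (- r) * a n))"
    by (simp add: abs_mult mult_ac)
  have "(\<integral>n. a n \<partial>measure_pmf (poisson_pmf r)) =
      (\<integral>n. r ^ n / fact n * exp (- r) * a n \<partial>count_space UNIV)"
    using assms(1) by (simp add: measure_pmf_eq_density integral_density)
  also have "\<dots> = (\<Sum>n. r ^ n / fact n * exp (- r) * a n)"
    using summable by (intro integral_count_space_nat) (simp add: integrable_count_space_nat_iff)
  also have "\<dots> = (\<Sum>n. exp (- r) * (r ^ n / fact n * a n))"
    by (simp add: mult_ac)
  also have "\<dots> = exp (- r) * (\<Sum>n. r ^ n / fact n * a n)"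
    by (rule suminf_mult[OF summable_norm_cancel[OF assms(2)]])
  finally show ?thesis .
qed

text \<open>The kernel makes a random number of \<open>Q\<close>-steps, Poisson distributed with
  mean \<open>r\<close>; this is where positivity and total mass one of the semigroup come
  from.\<close>

lemma markov_operator_poisson:
  assumes Q: "markov_operator N Q" and r: "0 \<le> r"
  shows "markov_operator N (\<lambda>f x. exp (- r) * op_exp Q r f x)"
proof -
  interpret Q: bounded_operator "space N" "bounded_measurable N" Q 1
    by (rule bounded_operator_markov[OF Q])
  show ?thesis
  \<comment> \<open>The series formula for Poisson integrals is available for positive means only;
    mean 0 is the identity.\<close>
  proof (cases "r = 0")
    case True
    with markov_operator_iterate[OF Q, of 0] show ?thesis by (simp add: Q.op_exp_0 id_def)
  next
    case False
    with r have r: "0 < r" by simp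
    have "\<exists>K. \<forall>n. K n \<in> N \<rightarrow>\<^sub>M prob_algebra N \<and>
      (\<forall>f\<in>bounded_measurable N. \<forall>x\<in>space N. (Q ^^ n) f x = (\<integral>y. f y \<partial>(K n x)))"
      using markov_operator_iterate[OF Q] unfolding markov_operator_def by (intro choice) blast
    then obtain K where K: "\<And>n. K n \<in> N \<rightarrow>\<^sub>M prob_algebra N"
      and Qn_eq: "\<And>n f x. f \<in> bounded_measurable N \<Longrightarrow> x \<in> space N \<Longrightarrow> (Q ^^ n) f x = (\<integral>y. f y \<partial>(K n x))"
      by blast
    let ?p = "measure_pmf (poisson_pmf r)"
    \<comment> \<open>Joint measurability follows from measurability for each fixed
      \<open>n\<close>, since \<open>n\<close> ranges over a countable set.\<close>
    have "(\<lambda>(x, n). K n x) \<in> N \<Otimes>\<^sub>M count_space UNIV \<rightarrow>\<^sub>M prob_algebra N"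
      unfolding case_prod_beta
      by (rule measurable_compose_countable[OF measurable_compose[OF measurable_fst K] measurable_snd])
    then have "(\<lambda>x. ?p \<bind> (\<lambda>n. K n x)) \<in> N \<rightarrow>\<^sub>M prob_algebra N"
      by (intro measurable_bind_prob_space2[where N = "count_space UNIV"] measurable_const)
         (auto simp: space_prob_algebra measure_pmf.prob_space_axioms)
    moreover have "exp (- r) * op_exp Q r f x = (\<integral>y. f y \<partial>(?p \<bind> (\<lambda>n. K n x)))"
      if f: "f \<in> bounded_measurable N" and x: "x \<in> space N" for f x
    proof -
      obtain B where B: "\<And>x. x \<in> space N \<Longrightarrow> \<bar>f x\<bar> \<le> B" "f \<in> borel_measurable N"
        using bounded_measurableE[OF f] by blast
      have "(\<integral>y. f y \<partial>(?p \<bind> (\<lambda>n. K n x))) = (\<integral>n. (\<integral>y. f y \<partial>(K n x)) \<partial>?p)"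
      proof (rule integral_bind[where K = N and B = B and B' = 1])
        show "(\<lambda>n. K n x) \<in> ?p \<rightarrow>\<^sub>M subprob_algebra N"
          using measurable_space[OF measurable_prob_algebraD[OF K] x] by simp
        show "AE n in ?p. emeasure (K n x) (space (K n x)) \<le> ennreal 1"
          by (rule AE_I2) (simp add: prob_space.emeasure_space_1[OF markov_kernelD(1)[OF K x]])
      qed (use B in \<open>auto intro: measure_pmf.finite_measure_axioms\<close>)
      also have "\<dots> = (\<integral>n. (Q ^^ n) f x \<partial>?p)"
        by (simp add: Qn_eq f x)
      also have "\<dots> = exp (- r) * op_exp Q r f x"
        unfolding op_exp_def using Q.op_exp_summable[OF f x, of r 0] r
        by (intro integral_poisson_pmf) simp_all
      finally show ?thesis ..
    qed
    ultimately show ?thesis unfolding markov_operator_def by blast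
  qed
qed

text \<open>The weights are carried by the subprobability kernels \<open>k i\<close> themselves, so
  the mixture is a bind over counting measure. Counting measure is no probability measure, but
  \<open>mass\<close> makes the resulting total mass 1.\<close>

lemma finite_mixture_kernel:
  assumes I: "finite I"
    and k: "\<And>i. i \<in> I \<Longrightarrow> k i \<in> N \<rightarrow>\<^sub>M subprob_algebra N"
    and mass: "\<And>x. x \<in> space N \<Longrightarrow> (\<Sum>i\<in>I. emeasure (k i x) (space N)) = 1"
  shows "markov_operator N (\<lambda>f x. \<Sum>i\<in>I. \<integral>y. f y \<partial>(k i x))"
proof -
  let ?K = "\<lambda>x. count_space I \<bind> (\<lambda>i. k i x)"
  have row: "(\<lambda>i. k i x) \<in> count_space I \<rightarrow>\<^sub>M subprob_algebra N" if "x \<in> space N" for x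
    using measurable_space[OF k that] by simp
  have ne: "I \<noteq> {}" if "x \<in> space N" for x
    using mass[OF that] by auto
  have em: "emeasure (?K x) A = (\<Sum>i\<in>I. emeasure (k i x) A)" if "x \<in> space N" "A \<in> sets N" for x A
    using emeasure_bind[OF _ row[OF that(1)] that(2)] ne[OF that(1)] I
    by (simp add: nn_integral_count_space_finite)
  have sets: "sets (?K x) = sets N" if "x \<in> space N" for x
    using row[OF that] ne[OF that] by (intro sets_bind) (auto dest: measurable_space simp: space_subprob_algebra)
  have prob: "prob_space (?K x)" if "x \<in> space N" for x
    using em[OF that sets.top] mass[OF that] sets_eq_imp_space_eq[OF sets[OF that]]
    by (intro prob_spaceI) simp
  have "?K \<in> N \<rightarrow>\<^sub>M prob_algebra N"
  proof (rule measurable_prob_algebraI[OF prob measurable_subprob_algebra])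
    fix A assume A: "A \<in> sets N"
    have "(\<lambda>x. \<Sum>i\<in>I. emeasure (k i x) A) \<in> borel_measurable N"
      by (intro borel_measurable_sum measurable_compose[OF k measurable_emeasure_subprob_algebra[OF A]])
    then show "(\<lambda>x. emeasure (?K x) A) \<in> borel_measurable N"
      using em[OF _ A] by (simp cong: measurable_cong)
  qed (use prob sets in \<open>auto intro: prob_space_imp_subprob_space\<close>)
  moreover have "(\<Sum>i\<in>I. \<integral>y. f y \<partial>(k i x)) = (\<integral>y. f y \<partial>(?K x))"
    if f: "f \<in> bounded_measurable N" and x: "x \<in> space N" for f x
  proof -
    obtain B where B: "\<And>x. x \<in> space N \<Longrightarrow> \<bar>f x\<bar> \<le> B" "f \<in> borel_measurable N"
      using bounded_measurableE[OF f] by blast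
    have "(\<integral>y. f y \<partial>(?K x)) = (\<integral>i. (\<integral>y. f y \<partial>(k i x)) \<partial>count_space I)"
    proof (rule integral_bind[where K = N and B = B and B' = 1])
      show "(\<lambda>i. k i x) \<in> count_space I \<rightarrow>\<^sub>M subprob_algebra N" using x by (rule row)
      show "AE i in count_space I. emeasure (k i x) (space (k i x)) \<le> ennreal 1"
        by (rule AE_I2) (simp add: subprob_space.emeasure_space_le_1[OF subprob_space_kernel[OF k x]])
    qed (use B I in \<open>auto intro: finite_measure_count_space\<close>)
    then show ?thesis using I by (simp add: lebesgue_integral_count_space_finite)
  qed
  ultimately show ?thesis unfolding markov_operator_def by blast
qed

section \<open>Jump processes\<close>

lemma (in bounded_operator) bounded_operator_generator:
  "bounded_operator X V (\<lambda>g x. q * (L g x - g x)) (\<bar>q\<bar> * (D + 1))"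
proof
  show "0 \<le> \<bar>q\<bar> * (D + 1)" using D_nonneg by simp
  show "(\<lambda>x. q * (L g x - g x)) \<in> V" if "g \<in> V" for g
    using linear_combination[OF op_member[OF that] that, of q "- q"] by (simp add: right_diff_distrib)
  show "q * (L (\<lambda>y. a * g y + b * h y) x - (a * g x + b * h x)) =
      a * (q * (L g x - g x)) + b * (q * (L h x - h x))"
    if "g \<in> V" "h \<in> V" "x \<in> X" for g h x a b
    by (simp add: op_linear[OF that] algebra_simps)
  show "\<bar>q * (L g x - g x)\<bar> \<le> \<bar>q\<bar> * (D + 1) * B"
    if g: "g \<in> V" and B: "\<And>y. y \<in> X \<Longrightarrow> \<bar>g y\<bar> \<le> B" and x: "x \<in> X" for g B x
  proof -
    have "\<bar>L g x - g x\<bar> \<le> (D + 1) * B"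
      using op_bound[OF g B x] B[OF x] by (simp add: distrib_right)
    then show ?thesis by (simp add: abs_mult mult.assoc mult_left_mono)
  qed
qed

lemma markov_operator_cong:
  assumes "markov_operator N Q"
    and "\<And>f x. f \<in> bounded_measurable N \<Longrightarrow> x \<in> space N \<Longrightarrow> Q' f x = Q f x"
  shows "markov_operator N Q'"
  using assms unfolding markov_operator_def by (metis (no_types, lifting))

section \<open>The jump mechanism and its embedded chain\<close>

lemma splice_measurable:
  assumes "S \<subseteq> T"
  shows "(\<lambda>(x, z). splice T S x z) \<in> config M T \<Otimes>\<^sub>M config M S \<rightarrow>\<^sub>M config M T"
  unfolding splice_def case_prod_beta
proof (rule measurable_restrict)
  fix i assume "i \<in> T"
  show "(\<lambda>p. if i \<in> S then snd p i else fst p i) \<in> config M T \<Otimes>\<^sub>M config M S \<rightarrow>\<^sub>M M"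
  proof (cases "i \<in> S")
    case True
    then show ?thesis
      by (simp add: measurable_compose[OF measurable_snd measurable_component_singleton])
  next
    case False
    with \<open>i \<in> T\<close> show ?thesis
      by (simp add: measurable_compose[OF measurable_fst measurable_component_singleton])
  qed
qed

lemma splice_measurable':
  assumes "S \<subseteq> T" "x \<in> space (config M T)"
  shows "splice T S x \<in> config M S \<rightarrow>\<^sub>M config M T"
  using measurable_Pair_compose_split[OF splice_measurable[OF assms(1)] measurable_const[OF assms(2)] measurable_ident]
  by simp

locale jump_process =
  fixes M :: "'a measure" and T :: "'i set"
    and J :: "'i set \<Rightarrow> ('i \<Rightarrow> 'a) \<Rightarrow> ('i \<Rightarrow> 'a) measure"
  assumes finite_T: "finite T"
    and kernel: "\<And>S. S \<subseteq> T \<Longrightarrow> bounded_kernel (config M T) (config M S) (J S)"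
begin

abbreviation "N \<equiv> config M T"

definition rate :: "'i set \<Rightarrow> ('i \<Rightarrow> 'a) \<Rightarrow> real" where
  "rate S x = measure (J S x) (space (config M S))"

lemma rate_nonneg: "0 \<le> rate S x"
  by (simp add: rate_def)

context
  fixes S x
  assumes S: "S \<subseteq> T" and x: "x \<in> space N"
begin

lemma sets_kernel: "sets (J S x) = sets (config M S)"
  using kernel[OF S] x by (simp add: bounded_kernel_def)

lemma space_kernel: "space (J S x) = space (config M S)"
  using sets_kernel by (rule sets_eq_imp_space_eq)

lemma finite_kernel: "finite_measure (J S x)"
proof
  have "emeasure (J S x) (space (J S x)) \<le> (SUP x\<in>space N. emeasure (J S x) (space (config M S)))"
    unfolding space_kernel using x by (rule SUP_upper)
  also have "\<dots> < \<infinity>" using kernel[OF S] by (simp add: bounded_kernel_def)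
  finally show "emeasure (J S x) (space (J S x)) \<noteq> \<infinity>" by simp
qed

lemma integrable_kernel:
  assumes "g \<in> bounded_measurable (config M S)"
  shows "integrable (J S x) g"
proof -
  obtain B where B: "\<And>z. z \<in> space (config M S) \<Longrightarrow> \<bar>g z\<bar> \<le> B" "g \<in> borel_measurable (config M S)"
    using bounded_measurableE[OF assms] by blast
  then have "g \<in> borel_measurable (J S x)"
    using measurable_cong_sets[OF sets_kernel refl] by blast
  with B finite_kernel show ?thesis
    by (intro finite_measure.integrable_bounded[where B = B]) (auto simp: space_kernel)
qed

lemma splice_bounded_measurable:
  assumes "f \<in> bounded_measurable N"
  shows "(\<lambda>z. f (splice T S x z)) \<in> bounded_measurable (config M S)"
proof -
  obtain B where B: "\<And>z. z \<in> space N \<Longrightarrow> \<bar>f z\<bar> \<le> B" "f \<in> borel_measurable N"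
    using bounded_measurableE[OF assms] by blast
  show ?thesis
    by (rule bounded_measurableI[OF measurable_compose[OF splice_measurable'[OF S x] B(2)]])
       (auto intro: B(1) measurable_space[OF splice_measurable'[OF S x]])
qed

lemma integral_jump:
  assumes "f \<in> bounded_measurable N"
  shows "(\<integral>z. (f (splice T S x z) - a) \<partial>(J S x)) = (\<integral>z. f (splice T S x z) \<partial>(J S x)) - a * rate S x"
proof -
  interpret finite_measure "J S x" by (rule finite_kernel)
  show ?thesis
    using integrable_kernel[OF splice_bounded_measurable[OF assms]]
    by (simp add: rate_def space_kernel)
qed

lemma emeasure_scaled_kernel:
  assumes "0 < \<Lambda>"
  shows "emeasure (density (J S x) (\<lambda>_. ennreal (1 / \<Lambda>))) (space (config M S)) = ennreal (rate S x / \<Lambda>)"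
proof -
  interpret finite_measure "J S x" by (rule finite_kernel)
  have "emeasure (density (J S x) (\<lambda>_. ennreal (1 / \<Lambda>))) (space (config M S)) =
      ennreal (1 / \<Lambda>) * emeasure (J S x) (space (config M S))"
    by (rule emeasure_density_const) (simp add: sets_kernel)
  also have "\<dots> = ennreal (rate S x / \<Lambda>)"
    using assms by (simp add: emeasure_eq_measure rate_def ennreal_mult'[symmetric])
  finally show ?thesis .
qed

end

lemma generator_eq:
  assumes "f \<in> bounded_measurable N" "x \<in> space N"
  shows "generator T J f x = (\<Sum>S\<in>Pow T. (\<integral>z. f (splice T S x z) \<partial>(J S x)) - f x * rate S x)"
  unfolding generator_def by (intro sum.cong refl integral_jump) (use assms in auto)

lemma rate_bound:
  obtains \<Lambda> where "0 < \<Lambda>" "\<And>x. x \<in> space N \<Longrightarrow> (\<Sum>S\<in>Pow T. rate S x) \<le> \<Lambda>"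
proof -
  have "\<exists>b. \<forall>S\<in>Pow T. \<forall>x\<in>space N. rate S x \<le> b S"
  proof (intro bchoice ballI)
    fix S assume "S \<in> Pow T"
    then have S: "S \<subseteq> T" by simp
    let ?s = "SUP x\<in>space N. emeasure (J S x) (space (config M S))"
    have s: "?s < \<infinity>" using kernel[OF S] by (simp add: bounded_kernel_def)
    have "rate S x \<le> enn2real ?s" if "x \<in> space N" for x
      unfolding rate_def measure_def using s that
      by (intro enn2real_mono SUP_upper) auto
    then show "\<exists>b. \<forall>x\<in>space N. rate S x \<le> b" by blast
  qed
  then obtain b where b: "\<And>S x. S \<subseteq> T \<Longrightarrow> x \<in> space N \<Longrightarrow> rate S x \<le> b S" by blast
  \<comment> \<open>The maximum with 1 keeps the bound positive, hence a legitimate divisor, even if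
    all rates vanish.\<close>
  have "(\<Sum>S\<in>Pow T. rate S x) \<le> max 1 (\<Sum>S\<in>Pow T. b S)" if "x \<in> space N" for x
    using sum_mono[of "Pow T" "\<lambda>S. rate S x" b] b that by (simp add: max.coboundedI2)
  then show thesis by (intro that[of "max 1 (\<Sum>S\<in>Pow T. b S)"]) auto
qed

definition step :: "real \<Rightarrow> (('i \<Rightarrow> 'a) \<Rightarrow> real) \<Rightarrow> ('i \<Rightarrow> 'a) \<Rightarrow> real" where
  "step \<Lambda> f x = f x + generator T J f x / \<Lambda>"

lemma generator_step: "\<Lambda> \<noteq> 0 \<Longrightarrow> generator T J = (\<lambda>f x. \<Lambda> * (step \<Lambda> f x - f x))"
  by (simp add: step_def fun_eq_iff)

lemma jump_kernel_measurable:
  assumes S: "S \<subseteq> T" and \<Lambda>: "0 < \<Lambda>"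
    and bound: "\<And>x. x \<in> space N \<Longrightarrow> rate S x \<le> \<Lambda>"
  shows "(\<lambda>x. distr (density (J S x) (\<lambda>_. ennreal (1 / \<Lambda>))) N (splice T S x)) \<in> N \<rightarrow>\<^sub>M subprob_algebra N"
proof (rule measurable_distr2[OF splice_measurable[OF S]], rule measurable_subprob_algebra)
  fix x assume x: "x \<in> space N"
  interpret finite_measure "J S x" by (rule finite_kernel[OF S x])
  show sets: "sets (density (J S x) (\<lambda>_. ennreal (1 / \<Lambda>))) = sets (config M S)"
    by (simp add: sets_kernel[OF S x])
  show "subprob_space (density (J S x) (\<lambda>_. ennreal (1 / \<Lambda>)))"
  proof
    show "emeasure (density (J S x) (\<lambda>_. ennreal (1 / \<Lambda>)))
      (space (density (J S x) (\<lambda>_. ennreal (1 / \<Lambda>)))) \<le> 1"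
      using bound[OF x] \<Lambda> by (simp add: space_kernel[OF S x] emeasure_scaled_kernel[OF S x])
    \<comment> \<open>A subprobability space must be nonempty; restricting the given configuration
      to \<open>S\<close> provides a point.\<close>
    have "restrict x S \<in> space (config M S)"
      using x S by (auto simp: space_PiM restrict_PiE_iff)
    then have "space (config M S) \<noteq> {}" by blast
    then show "space (density (J S x) (\<lambda>_. ennreal (1 / \<Lambda>))) \<noteq> {}"
      by (simp add: space_kernel[OF S x])
  qed
next
  fix A assume A: "A \<in> sets (config M S)"
  have "(\<lambda>x. emeasure (J S x) A) \<in> borel_measurable N"
    using kernel[OF S] A by (simp add: bounded_kernel_def)
  then have "(\<lambda>x. ennreal (1 / \<Lambda>) * emeasure (J S x) A) \<in> borel_measurable N"
    by measurable
  then show "(\<lambda>x. emeasure (density (J S x) (\<lambda>_. ennreal (1 / \<Lambda>))) A) \<in> borel_measurable N"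
    using A by (subst measurable_cong[of N _ "\<lambda>x. ennreal (1 / \<Lambda>) * emeasure (J S x) A"])
      (auto simp: emeasure_density_const sets_kernel[OF S])
qed

lemma rate_measurable:
  assumes "S \<subseteq> T"
  shows "rate S \<in> borel_measurable N"
proof -
  have "(\<lambda>x. emeasure (J S x) (space (config M S))) \<in> borel_measurable N"
    using kernel[OF assms] by (simp add: bounded_kernel_def)
  then show ?thesis
    unfolding rate_def[abs_def] measure_def by (rule measurable_compose) simp
qed

lemma markov_operator_step:
  assumes \<Lambda>: "0 < \<Lambda>" and bound: "\<And>x. x \<in> space N \<Longrightarrow> (\<Sum>S\<in>Pow T. rate S x) \<le> \<Lambda>"
  shows "markov_operator N (step \<Lambda>)"
proof -
  \<comment> \<open>The chain stays put with weight \<open>w x\<close> (index \<open>None\<close>)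
    and updates the sites of \<open>S\<close> with weight \<open>rate S x / \<Lambda>\<close> (index
    \<open>Some S\<close>). The holding weight is nonnegative because \<Lambda> bounds the total
    rate.\<close>
  define w where "w x = 1 - (\<Sum>S\<in>Pow T. rate S x) / \<Lambda>" for x
  define k where "k i x = (case i of
      None \<Rightarrow> density (return N x) (\<lambda>_. ennreal (w x))
    | Some S \<Rightarrow> distr (density (J S x) (\<lambda>_. ennreal (1 / \<Lambda>))) N (splice T S x))" for i x
  define I where "I = insert None (Some ` Pow T)"
  have I: "finite I" using finite_T by (simp add: I_def)
  have sum_I: "sum h I = h None + (\<Sum>S\<in>Pow T. h (Some S))" for h :: "'i set option \<Rightarrow> 'c::comm_monoid_add"
    unfolding I_def using finite_T by (subst sum.insert) (auto simp: sum.reindex)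
  have w: "0 \<le> w x" "w x \<le> 1" if "x \<in> space N" for x
    using bound[OF that] \<Lambda> by (auto simp: w_def field_simps intro!: sum_nonneg rate_nonneg)
  have rate_le: "rate S x \<le> \<Lambda>" if "S \<subseteq> T" "x \<in> space N" for S x
    using member_le_sum[of S "Pow T" "\<lambda>S. rate S x"] bound[OF that(2)] that(1) finite_T rate_nonneg
    by force
  have [measurable]: "w \<in> borel_measurable N"
    unfolding w_def[abs_def]
    by (intro borel_measurable_diff borel_measurable_divide borel_measurable_sum rate_measurable) auto
  have em_None: "emeasure (k None x) A = ennreal (w x) * indicator A x" if "A \<in> sets N" for A x
    using that by (simp add: k_def emeasure_density_const)
  have "markov_operator N (\<lambda>f x. \<Sum>i\<in>I. \<integral>y. f y \<partial>(k i x))"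
  proof (rule finite_mixture_kernel[OF I])
    fix i assume "i \<in> I"
    show "k i \<in> N \<rightarrow>\<^sub>M subprob_algebra N"
    proof (cases i)
      case None
      show ?thesis unfolding None
      proof (rule measurable_subprob_algebra)
        fix x assume x: "x \<in> space N"
        show "subprob_space (k None x)"
        proof
          show "emeasure (k None x) (space (k None x)) \<le> 1"
            using em_None[OF sets.top, of x] w(2)[OF x] x by (simp add: k_def)
          have "space N \<noteq> {}" using x by blast
          then show "space (k None x) \<noteq> {}" by (simp add: k_def)
        qed
        show "sets (k None x) = sets N" by (simp add: k_def)
      next
        fix A assume [measurable]: "A \<in> sets N"
        show "(\<lambda>x. emeasure (k None x) A) \<in> borel_measurable N"
          by (simp add: em_None)
      qed
    next
      case (Some S)
      with \<open>i \<in> I\<close> have S: "S \<subseteq> T" by (auto simp: I_def)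
      show ?thesis using jump_kernel_measurable[OF S \<Lambda> rate_le[OF S]] by (simp add: k_def[abs_def] Some)
    qed
  next
    fix x assume x: "x \<in> space N"
    have "emeasure (k (Some S) x) (space N) = ennreal (rate S x / \<Lambda>)" if "S \<in> Pow T" for S
    proof -
      have S: "S \<subseteq> T" using that by simp
      interpret finite_measure "J S x" by (rule finite_kernel[OF S x])
      have "splice T S x \<in> J S x \<rightarrow>\<^sub>M N"
        using splice_measurable'[OF S x] measurable_cong_sets[OF sets_kernel[OF S x] refl] by blast
      moreover from this have "splice T S x -` space N \<inter> space (J S x) = space (J S x)"
        by (auto dest: measurable_space)
      ultimately have "emeasure (k (Some S) x) (space N) =
          emeasure (density (J S x) (\<lambda>_. ennreal (1 / \<Lambda>))) (space (J S x))"
        by (simp add: k_def emeasure_distr)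
      also have "\<dots> = ennreal (rate S x / \<Lambda>)"
        using \<Lambda> by (simp add: space_kernel[OF S x] emeasure_scaled_kernel[OF S x])
      finally show ?thesis .
    qed
    then have "(\<Sum>i\<in>I. emeasure (k i x) (space N)) = ennreal (w x) + (\<Sum>S\<in>Pow T. ennreal (rate S x / \<Lambda>))"
      using x by (simp add: sum_I em_None)
    also have "\<dots> = ennreal (w x + (\<Sum>S\<in>Pow T. rate S x / \<Lambda>))"
      using w[OF x] \<Lambda> by (simp add: sum_ennreal rate_nonneg ennreal_plus sum_nonneg)
    also have "w x + (\<Sum>S\<in>Pow T. rate S x / \<Lambda>) = 1"
      by (simp add: w_def sum_divide_distrib)
    finally show "(\<Sum>i\<in>I. emeasure (k i x) (space N)) = 1" by simp
  qed
  then show ?thesis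
  proof (rule markov_operator_cong)
    fix f x assume f: "f \<in> bounded_measurable N" and x: "x \<in> space N"
    have [measurable]: "f \<in> borel_measurable N" using f by (simp add: bounded_measurable_def)
    have "(\<integral>y. f y \<partial>(k None x)) = w x * f x"
      unfolding k_def option.case using w[OF x] x
      by (subst integral_density) (auto simp: integral_return)
    moreover have "(\<integral>y. f y \<partial>(k (Some S) x)) = (\<integral>z. f (splice T S x z) \<partial>(J S x)) / \<Lambda>" if "S \<in> Pow T" for S
    proof -
      have S: "S \<subseteq> T" using that by simp
      have [measurable]: "splice T S x \<in> J S x \<rightarrow>\<^sub>M N"
        using splice_measurable'[OF S x] measurable_cong_sets[OF sets_kernel[OF S x] refl] by blast
      show ?thesis
        unfolding k_def option.case using \<Lambda>
        by (subst integral_distr, simp, simp, subst integral_density) simp_all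
    qed
    ultimately have "(\<Sum>i\<in>I. \<integral>y. f y \<partial>(k i x)) =
        w x * f x + (\<Sum>S\<in>Pow T. (\<integral>z. f (splice T S x z) \<partial>(J S x)) / \<Lambda>)"
      by (simp add: sum_I)
    also have "\<dots> = step \<Lambda> f x"
      using \<Lambda> by (simp add: step_def generator_eq[OF f x] w_def sum_subtractf sum_distrib_left[symmetric]
          sum_divide_distrib[symmetric] field_simps)
    finally show "step \<Lambda> f x = (\<Sum>i\<in>I. \<integral>y. f y \<partial>(k i x))" ..
  qed
qed

text \<open>Boundedness is inherited from the step operator, which has norm at most 1, through
  \<open>generator T J = \<Lambda> (step \<Lambda> - I)\<close>.\<close>

lemma bounded_operator_generator:
  obtains D where "bounded_operator (space N) (bounded_measurable N) (generator T J) D"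
proof -
  obtain \<Lambda> where \<Lambda>: "0 < \<Lambda>" and bound: "\<And>x. x \<in> space N \<Longrightarrow> (\<Sum>S\<in>Pow T. rate S x) \<le> \<Lambda>"
    using rate_bound by blast
  interpret step: bounded_operator "space N" "bounded_measurable N" "step \<Lambda>" 1
    by (intro bounded_operator_markov markov_operator_step \<Lambda> bound)
  show thesis
    using step.bounded_operator_generator[of \<Lambda>] \<Lambda> by (intro that) (simp add: generator_step[of \<Lambda>])
qed

lemma op_exp_generator:
  assumes \<Lambda>: "0 < \<Lambda>" and bound: "\<And>x. x \<in> space N \<Longrightarrow> (\<Sum>S\<in>Pow T. rate S x) \<le> \<Lambda>"
    and f: "f \<in> bounded_measurable N" and x: "x \<in> space N"
  shows "op_exp (generator T J) t f x = exp (- (\<Lambda> * t)) * op_exp (step \<Lambda>) (\<Lambda> * t) f x"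
proof -
  obtain D where "bounded_operator (space N) (bounded_measurable N) (generator T J) D"
    by (rule bounded_operator_generator)
  then interpret bounded_operator "space N" "bounded_measurable N" "generator T J" D .
  show ?thesis
  proof (rule op_exp_uniformization)
    show "bounded_operator (space N) (bounded_measurable N) (step \<Lambda>) 1"
      by (intro bounded_operator_markov markov_operator_step \<Lambda> bound)
  qed (use \<Lambda> f x in \<open>simp_all add: step_def\<close>)
qed

text \<open>Only the kernel clause uses the Poisson representation; invariance, the semigroup law
  and norm continuity hold for the exponential of any bounded operator.\<close>

theorem markov_semigroup_generator: "markov_semigroup N (op_exp (generator T J))"
proof -
  obtain D where "bounded_operator (space N) (bounded_measurable N) (generator T J) D"
    by (rule bounded_operator_generator)
  then interpret bounded_operator "space N" "bounded_measurable N" "generator T J" D .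
  obtain \<Lambda> where \<Lambda>: "0 < \<Lambda>" and bound: "\<And>x. x \<in> space N \<Longrightarrow> (\<Sum>S\<in>Pow T. rate S x) \<le> \<Lambda>"
    using rate_bound by blast
  have "markov_operator N (op_exp (generator T J) t)" if "0 \<le> t" for t
    by (rule markov_operator_cong[OF markov_operator_poisson[OF markov_operator_step[OF \<Lambda> bound], of "\<Lambda> * t"]])
       (use \<Lambda> that in \<open>auto simp: op_exp_generator[OF \<Lambda> bound]\<close>)
  then show ?thesis
    unfolding markov_semigroup_def markov_operator_def[symmetric]
    by (auto intro: op_exp_member op_exp_0 op_exp_add uniform_limit_op_exp)
qed

end

section \<open>Propagation of Lipschitz coefficients\<close>

text \<open>The action on column vectors. It turns matrices over \<open>T\<close> into bounded
  operators on functions over \<open>T\<close>, so that the operator theory above applies to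
  them.\<close>

definition matrix_op :: "'i set \<Rightarrow> ('i \<Rightarrow> 'i \<Rightarrow> real) \<Rightarrow> ('i \<Rightarrow> real) \<Rightarrow> 'i \<Rightarrow> real" where
  "matrix_op T A g i = (\<Sum>k\<in>T. A i k * g k)"

lemma bounded_operator_matrix_op:
  assumes T: "finite T"
  shows "bounded_operator T UNIV (matrix_op T A) (\<Sum>i\<in>T. \<Sum>k\<in>T. \<bar>A i k\<bar>)"
proof
  show "bounded (g ` T)" for g :: "'a \<Rightarrow> real"
    using T by (intro finite_imp_bounded finite_imageI)
  show "0 \<le> (\<Sum>i\<in>T. \<Sum>k\<in>T. \<bar>A i k\<bar>)"
    by (intro sum_nonneg) simp
  show "matrix_op T A (\<lambda>y. a * g y + b * h y) i = a * matrix_op T A g i + b * matrix_op T A h i" for a b g h i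
    by (simp add: matrix_op_def distrib_left sum.distrib sum_distrib_left mult_ac)
  show "\<bar>matrix_op T A g i\<bar> \<le> (\<Sum>i\<in>T. \<Sum>k\<in>T. \<bar>A i k\<bar>) * B"
    if B: "\<And>k. k \<in> T \<Longrightarrow> \<bar>g k\<bar> \<le> B" and i: "i \<in> T" for g i B
  proof -
    have "0 \<le> B" using B[OF i] by linarith
    have "\<bar>matrix_op T A g i\<bar> \<le> (\<Sum>k\<in>T. \<bar>A i k\<bar> * B)"
      unfolding matrix_op_def
      by (rule order_trans[OF sum_abs]) (auto simp: abs_mult intro!: sum_mono mult_left_mono B)
    also have "\<dots> = (\<Sum>k\<in>T. \<bar>A i k\<bar>) * B"
      by (simp add: sum_distrib_right)
    also have "\<dots> \<le> (\<Sum>i\<in>T. \<Sum>k\<in>T. \<bar>A i k\<bar>) * B"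
      using member_le_sum[OF i, of "\<lambda>i. \<Sum>k\<in>T. \<bar>A i k\<bar>"] T \<open>0 \<le> B\<close>
      by (intro mult_right_mono) (auto intro: sum_nonneg)
    finally show ?thesis .
  qed
qed auto

text \<open>Left multiplication acts on each column separately, and column \<open>j\<close> of the
  identity is the \<open>j\<close>-th unit vector.\<close>

lemma mat_power_column:
  "(mat_mult T A ^^ n) mat_id i j = (matrix_op T A ^^ n) (\<lambda>i. mat_id i j) i"
  by (induction n arbitrary: i) (simp_all add: mat_mult_def matrix_op_def)

lemma mat_exp_column: "mat_exp T A i j = op_exp (matrix_op T A) 1 (\<lambda>i. mat_id i j) i"
  by (simp add: mat_exp_def op_exp_def mat_power_column)

text \<open>Time is already absorbed into the matrix \<open>A\<close>, so the operator exponential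
  is taken at time 1 and \<open>q\<close> stands for the product of \<Lambda> and time.\<close>

lemma mat_exp_uniformization:
  assumes T: "finite T"
    and A: "\<And>i k. i \<in> T \<Longrightarrow> k \<in> T \<Longrightarrow> A i k = q * (B i k - mat_id i k)"
    and i: "i \<in> T"
  shows "mat_exp T A i j = exp (- q) * op_exp (matrix_op T B) q (\<lambda>i. mat_id i j) i"
proof -
  interpret bounded_operator T UNIV "matrix_op T A" "\<Sum>i\<in>T. \<Sum>k\<in>T. \<bar>A i k\<bar>"
    using T by (rule bounded_operator_matrix_op)
  have "matrix_op T A g x = q * (matrix_op T B g x - g x)" if x: "x \<in> T" for g x
  proof -
    have "(\<Sum>k\<in>T. mat_id x k * g k) = g x"
      using T x by (simp add: mat_id_def if_distrib[of "\<lambda>c. c * _"] sum.delta cong: if_cong)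
    then show ?thesis
      by (simp add: matrix_op_def A x mult.assoc left_diff_distrib sum_subtractf flip: sum_distrib_left)
  qed
  then show ?thesis
    using op_exp_uniformization[OF bounded_operator_matrix_op[OF T], of q B "\<lambda>i. mat_id i j" i 1] i
    by (simp add: mat_exp_column)
qed

lemma matrix_op_iterate_nonneg:
  assumes "\<And>i k. i \<in> T \<Longrightarrow> k \<in> T \<Longrightarrow> 0 \<le> B i k" "\<And>i. i \<in> T \<Longrightarrow> 0 \<le> g i" "i \<in> T"
  shows "0 \<le> (matrix_op T B ^^ n) g i"
  using assms(3) by (induction n arbitrary: i) (auto simp: matrix_op_def assms intro!: sum_nonneg)

section \<open>Lipschitz coefficients as real inequalities\<close>

text \<open>The common ground of both settings: positive distances allow the quotients in
  \<open>delta\<close> to be cleared of denominators.\<close>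

definition positive_off_diagonal :: "'a measure \<Rightarrow> ('a \<Rightarrow> 'a \<Rightarrow> real) \<Rightarrow> bool" where
  "positive_off_diagonal M d \<longleftrightarrow> (\<forall>x\<in>space M. \<forall>y\<in>space M. x \<noteq> y \<longrightarrow> 0 < d x y)"

lemma positive_off_diagonal_setting:
  assumes "polish_setting M d \<or> trivial_metric_setting M d"
  shows "positive_off_diagonal M d"
  using assms
  by (auto simp: positive_off_diagonal_def polish_setting_def trivial_metric_setting_def Metric_space.mdist_pos_less)

lemma config_component: "x \<in> space (config M S) \<Longrightarrow> i \<in> S \<Longrightarrow> x i \<in> space M"
  by (auto simp: space_PiM)

lemma delta_nonneg: "0 \<le> delta M d S i f"
  unfolding delta_def by (rule Sup_upper) simp

text \<open>This moves between extended-real suprema and real estimates. Nonnegativity of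
  \<open>l\<close> matches the 0 inserted into the supremum.\<close>

lemma delta_le_iff:
  assumes "positive_off_diagonal M d" "i \<in> S" "0 \<le> l"
  shows "delta M d S i f \<le> ereal l \<longleftrightarrow>
    (\<forall>x\<in>space (config M S). \<forall>y\<in>space (config M S). (\<forall>k\<in>S. k \<noteq> i \<longrightarrow> x k = y k) \<longrightarrow> x i \<noteq> y i \<longrightarrow>
      \<bar>f y - f x\<bar> \<le> l * d (y i) (x i))"
proof -
  have "ereal (\<bar>f y - f x\<bar> / d (y i) (x i)) \<le> ereal l \<longleftrightarrow> \<bar>f y - f x\<bar> \<le> l * d (y i) (x i)"
    if "x \<in> space (config M S)" "y \<in> space (config M S)" "x i \<noteq> y i" for x y
  proof -
    have "0 < d (y i) (x i)"
      using assms(1) that config_component[OF that(1) assms(2)] config_component[OF that(2) assms(2)]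
      by (auto simp: positive_off_diagonal_def)
    then show ?thesis by (simp add: pos_divide_le_eq)
  qed
  moreover have "(\<forall>z\<in>insert 0 {F x y |x y. P x y}. z \<le> ereal l) \<longleftrightarrow> (\<forall>x y. P x y \<longrightarrow> F x y \<le> ereal l)"
    for F :: "('b \<Rightarrow> 'a) \<Rightarrow> ('b \<Rightarrow> 'a) \<Rightarrow> ereal" and P
    using assms(3) by auto
  ultimately show ?thesis
    unfolding delta_def Sup_le_iff by auto
qed

lemma C_Lip_iff:
  assumes "finite S"
  shows "f \<in> C_Lip M d S \<longleftrightarrow> f \<in> bounded_measurable (config M S) \<and> (\<forall>i\<in>S. delta M d S i f < \<infinity>)"
proof -
  have "(SUP i\<in>S. delta M d S i f) < \<infinity> \<longleftrightarrow> (\<forall>i\<in>S. delta M d S i f < \<infinity>)"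
  \<comment> \<open>Over an empty index set the supremum is the bottom element; otherwise it is a
    maximum of finitely many values.\<close>
  proof (cases "S = {}")
    case True
    then show ?thesis by (simp add: bot_ereal_def)
  next
    case False
    then have "(SUP i\<in>S. delta M d S i f) = Max ((\<lambda>i. delta M d S i f) ` S)"
      using assms by (subst Max_Sup) auto
    moreover have "\<dots> < \<infinity> \<longleftrightarrow> (\<forall>i\<in>S. delta M d S i f < \<infinity>)"
      using assms False by (subst Max_less_iff) auto
    ultimately show ?thesis by (simp only:)
  qed
  then show ?thesis by (simp add: C_Lip_def)
qed

lemma C_LipI:
  assumes "finite S" "f \<in> bounded_measurable (config M S)"
    and "\<And>i. i \<in> S \<Longrightarrow> delta M d S i f \<le> ereal (l i)"
  shows "f \<in> C_Lip M d S"
proof -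
  have "delta M d S i f < \<infinity>" if "i \<in> S" for i
    using assms(3)[OF that] by (rule le_less_trans) simp
  with assms(1,2) show ?thesis by (simp add: C_Lip_iff)
qed

lemma C_Lip_obtain_constants:
  assumes "finite S" "f \<in> C_Lip M d S"
  obtains l where "\<And>i. i \<in> S \<Longrightarrow> 0 \<le> l i" "\<And>i. i \<in> S \<Longrightarrow> delta M d S i f = ereal (l i)"
proof
  fix i assume "i \<in> S"
  with assms have "delta M d S i f < \<infinity>" by (simp add: C_Lip_iff)
  with delta_nonneg[of M d S i f] show "0 \<le> real_of_ereal (delta M d S i f)"
    "delta M d S i f = ereal (real_of_ereal (delta M d S i f))"
    by (auto simp: ereal_real real_of_ereal_pos)
qed

lemma delta_empty_space:
  assumes "space (config M S) = {}"
  shows "delta M d S i f = 0"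
  unfolding delta_def assms by simp

lemma splice_difference:
  assumes "\<forall>k\<in>T. k \<noteq> j \<longrightarrow> x k = y k"
  shows "j \<in> S \<Longrightarrow> splice T S x z = splice T S y z"
    and "\<forall>k\<in>T. k \<noteq> j \<longrightarrow> splice T S x z k = splice T S y z k"
  using assms by (auto simp: splice_def fun_eq_iff)

text \<open>Freezing the sites outside \<open>S\<close> at \<open>y\<close> turns two configurations
  on \<open>S\<close> differing only at \<open>i\<close> into two on \<open>T\<close> differing only
  at \<open>i\<close>, with the same values there.\<close>

lemma delta_splice_le:
  assumes d: "positive_off_diagonal M d" and S: "S \<subseteq> T" and y: "y \<in> space (config M T)"
    and i: "i \<in> S" and l: "0 \<le> l" "delta M d T i f \<le> ereal l"
  shows "delta M d S i (\<lambda>z. f (splice T S y z)) \<le> ereal l"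
proof -
  have iT: "i \<in> T" using S i by blast
  note f = l(2)[unfolded delta_le_iff[OF d iT l(1)]]
  show ?thesis
    unfolding delta_le_iff[OF d i l(1)]
  proof (intro ballI impI)
    fix z z' assume z: "z \<in> space (config M S)" "z' \<in> space (config M S)"
      and eq: "\<forall>k\<in>S. k \<noteq> i \<longrightarrow> z k = z' k" and ne: "z i \<noteq> z' i"
    have *: "splice T S y z \<in> space (config M T)" "splice T S y z' \<in> space (config M T)"
      using measurable_space[OF splice_measurable'[OF S y]] z by auto
    have i_eq: "splice T S y w i = w i" for w
      using i iT by (simp add: splice_def)
    have "\<forall>k\<in>T. k \<noteq> i \<longrightarrow> splice T S y z k = splice T S y z' k"
      using eq by (auto simp: splice_def)
    with f * ne show "\<bar>f (splice T S y z') - f (splice T S y z)\<bar> \<le> l * d (z' i) (z i)"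
      by (metis i_eq)
  qed
qed

section \<open>One-step comparison of neighbouring configurations\<close>

locale lipschitz_jump_process = jump_process M T J
  for M :: "'a measure" and T :: "'i set"
    and J :: "'i set \<Rightarrow> ('i \<Rightarrow> 'a) \<Rightarrow> ('i \<Rightarrow> 'a) measure" +
  fixes d :: "'a \<Rightarrow> 'a \<Rightarrow> real" and c :: "'i set \<Rightarrow> 'i \<Rightarrow> real"
  assumes metric: "positive_off_diagonal M d"
    and admissible: "\<And>S j. S \<subseteq> T \<Longrightarrow> j \<in> T \<Longrightarrow> admissible_const M d T S (J S) j (c S j)"
begin

lemma c_nonneg: "S \<subseteq> T \<Longrightarrow> j \<in> T \<Longrightarrow> 0 \<le> c S j"
  using admissible by (simp add: admissible_const_def)

lemma interaction_nonneg: "j \<in> T \<Longrightarrow> 0 \<le> interaction T c i j"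
  unfolding interaction_def by (auto intro!: sum_nonneg c_nonneg)

text \<open>The integrand is frozen at \<open>y\<close> and only the kernel moves, so the hypothesis
  on \<open>c\<close> applies with this integrand as test function. Subtracting the constant
  \<open>f y\<close> alters none of its Lipschitz coefficients.\<close>

lemma kernel_difference_le:
  assumes S: "S \<subseteq> T" and j: "j \<in> T" and f: "f \<in> C_Lip M d T"
    and l: "\<And>i. i \<in> T \<Longrightarrow> 0 \<le> l i" "\<And>i. i \<in> T \<Longrightarrow> delta M d T i f \<le> ereal (l i)"
    and x: "x \<in> space N" and y: "y \<in> space N"
    and eq: "\<forall>k\<in>T. k \<noteq> j \<longrightarrow> x k = y k" and ne: "x j \<noteq> y j"
  shows "\<bar>(\<integral>z. (f (splice T S y z) - f y) \<partial>(J S y)) - (\<integral>z. (f (splice T S y z) - f y) \<partial>(J S x))\<bar> \<le>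
    c S j * (\<Sum>i\<in>S. l i) * d (y j) (x j)"
proof -
  let ?g = "\<lambda>z. f (splice T S y z) - f y"
  have finite_S: "finite S" using S finite_T by (rule finite_subset)
  have fb: "f \<in> bounded_measurable N" using f by (simp add: C_Lip_def)
  interpret S: function_space "space (config M S)" "bounded_measurable (config M S)"
    by (rule function_space_bounded_measurable)
  have const: "(\<lambda>_. f y) \<in> bounded_measurable (config M S)"
    by (rule bounded_measurableI[where B = "\<bar>f y\<bar>"]) auto
  have lS: "0 \<le> l i" "delta M d T i f \<le> ereal (l i)" if "i \<in> S" for i
    using l S that by auto
  have delta_g: "delta M d S i ?g \<le> ereal (l i)" if "i \<in> S" for i
    using delta_splice_le[OF metric S y that lS[OF that]] by (simp add: delta_def)
  then have g: "?g \<in> C_Lip M d S"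
    by (rule C_LipI[OF finite_S S.diff_member[OF splice_bounded_measurable[OF S y fb] const]])
  have "delta M d T j (\<lambda>x. \<integral>z. ?g z \<partial>(J S x)) \<le> ereal (c S j) * (\<Sum>i\<in>S. delta M d S i ?g)"
    using admissible[OF S j] g by (auto simp: admissible_const_def)
  also have "\<dots> \<le> ereal (c S j) * (\<Sum>i\<in>S. ereal (l i))"
    using c_nonneg[OF S j] delta_g by (intro ereal_mult_left_mono sum_mono) auto
  also have "\<dots> = ereal (c S j * (\<Sum>i\<in>S. l i))" by simp
  finally have "delta M d T j (\<lambda>x. \<integral>z. ?g z \<partial>(J S x)) \<le> ereal (c S j * (\<Sum>i\<in>S. l i))" .
  moreover have "0 \<le> c S j * (\<Sum>i\<in>S. l i)"
    using lS c_nonneg[OF S j] by (auto intro!: mult_nonneg_nonneg sum_nonneg)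
  ultimately show ?thesis
    using x y eq ne by (simp add: delta_le_iff[OF metric j])
qed

text \<open>Regrouping the pairs \<open>i \<in> S\<close> by \<open>i\<close> instead of by
  \<open>S\<close> is what assembles the matrix C from the constants of the single kernels.\<close>

lemma interaction_sum:
  "(\<Sum>S\<in>Pow T. c S j * (\<Sum>i\<in>S. l i)) = (\<Sum>i\<in>T. l i * interaction T c i j)"
proof -
  have "(\<Sum>S\<in>Pow T. c S j * (\<Sum>i\<in>S. l i)) = (\<Sum>S\<in>Pow T. \<Sum>i\<in>{i. i \<in> T \<and> i \<in> S}. l i * c S j)"
  proof (rule sum.cong[OF refl])
    fix S assume "S \<in> Pow T"
    then have "{i. i \<in> T \<and> i \<in> S} = S" by auto
    then show "c S j * (\<Sum>i\<in>S. l i) = (\<Sum>i\<in>{i. i \<in> T \<and> i \<in> S}. l i * c S j)"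
      by (simp add: sum_distrib_right mult.commute[of "c S j"])
  qed
  also have "\<dots> = (\<Sum>i\<in>T. \<Sum>S\<in>{S. S \<in> Pow T \<and> i \<in> S}. l i * c S j)"
    using finite_T by (intro sum.swap_restrict) auto
  finally show ?thesis by (simp add: interaction_def sum_distrib_left)
qed

definition step_matrix :: "real \<Rightarrow> 'i \<Rightarrow> 'i \<Rightarrow> real" where
  "step_matrix \<Lambda> i j = mat_id i j + (interaction T c i j - min_rate M T J * mat_id i j) / \<Lambda>"

lemma min_rate_le:
  assumes x: "x \<in> space N" and i: "i \<in> T"
  shows "min_rate M T J \<le> (\<Sum>S | S \<subseteq> T \<and> i \<in> S. rate S x)"
proof -
  let ?r = "\<lambda>x i. \<Sum>S | S \<subseteq> T \<and> i \<in> S. rate S x"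
  have bdd: "bdd_below (?r x ` T)" for x
    using finite_T by simp
  \<comment> \<open>Real infima require lower bounds: the inner family is finite, and the inner
    infima are nonnegative because \<open>T\<close> contains \<open>i\<close>.\<close>
  have "bdd_below ((\<lambda>x. INF i\<in>T. ?r x i) ` space N)"
    using i by (intro bdd_belowI2[where m = 0] cINF_greatest sum_nonneg rate_nonneg) auto
  then have "(INF x\<in>space N. INF i\<in>T. ?r x i) \<le> (INF i\<in>T. ?r x i)"
    using x by (rule cINF_lower)
  also have "\<dots> \<le> ?r x i"
    using bdd i by (rule cINF_lower)
  finally show ?thesis by (simp add: min_rate_def rate_def)
qed

text \<open>
  For \<open>S\<close> containing \<open>j\<close> the jump from \<open>x\<close> and from \<open>y\<close> ends in the same configuration,
  which is where the contraction rate comes from.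
\<close>

lemma delta_step_le:
  assumes \<Lambda>: "0 < \<Lambda>" and bound: "\<And>x. x \<in> space N \<Longrightarrow> (\<Sum>S\<in>Pow T. rate S x) \<le> \<Lambda>"
    and f: "f \<in> C_Lip M d T"
    and l: "\<And>i. i \<in> T \<Longrightarrow> 0 \<le> l i" "\<And>i. i \<in> T \<Longrightarrow> delta M d T i f \<le> ereal (l i)"
    and x: "x \<in> space N" and y: "y \<in> space N" and j: "j \<in> T"
    and eq: "\<forall>k\<in>T. k \<noteq> j \<longrightarrow> x k = y k" and ne: "x j \<noteq> y j"
  shows "\<bar>step \<Lambda> f y - step \<Lambda> f x\<bar> \<le> (\<Sum>i\<in>T. l i * step_matrix \<Lambda> i j) * d (y j) (x j)"
proof -
  define \<rho> where "\<rho> = d (y j) (x j)"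
  have \<rho>: "0 < \<rho>"
    using metric ne config_component[OF x j] config_component[OF y j]
    by (auto simp: \<rho>_def positive_off_diagonal_def)
  have fb: "f \<in> bounded_measurable N" using f by (simp add: C_Lip_def)
  have Lip: "\<bar>f v - f u\<bar> \<le> l j * d (v j) (u j)"
    if "u \<in> space N" "v \<in> space N" "\<forall>k\<in>T. k \<noteq> j \<longrightarrow> u k = v k" "u j \<noteq> v j" for u v
    using l(2)[OF j] that by (simp add: delta_le_iff[OF metric j l(1)[OF j]])
  \<comment> \<open>The generator difference is split in three: \<open>A\<close> changes the kernel
    with integrand frozen at \<open>y\<close>, \<open>B\<close> changes the starting configuration
    under the kernel at \<open>x\<close>, and the remainder is \<open>f y - f x\<close> times the
    jump rate at \<open>x\<close>.\<close>
  define A where "A S = (\<integral>z. (f (splice T S y z) - f y) \<partial>(J S y)) - (\<integral>z. (f (splice T S y z) - f y) \<partial>(J S x))" for S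
  define B where "B S = (\<integral>z. f (splice T S y z) - f (splice T S x z) \<partial>(J S x))" for S
  have A: "\<bar>A S\<bar> \<le> c S j * (\<Sum>i\<in>S. l i) * \<rho>" if "S \<in> Pow T" for S
    using kernel_difference_le[OF _ j f l x y eq ne, of S] that by (simp add: A_def \<rho>_def)
  have B: "\<bar>B S\<bar> \<le> (if j \<in> S then 0 else rate S x) * (l j * \<rho>)" if "S \<in> Pow T" for S
  proof -
    have S: "S \<subseteq> T" using that by simp
    interpret finite_measure "J S x" by (rule finite_kernel[OF S x])
    note splice = measurable_space[OF splice_measurable'[OF S]]
    show ?thesis
    proof (cases "j \<in> S")
      case True
      then show ?thesis using splice_difference(1)[OF eq] by (simp add: B_def)
    next
      case False
      have "\<bar>f (splice T S y z) - f (splice T S x z)\<bar> \<le> l j * \<rho>" if "z \<in> space (J S x)" for z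
      proof -
        have "splice T S w z j = w j" for w
          using False j by (simp add: splice_def)
        then show ?thesis
          using Lip[OF splice[OF x] splice[OF y] splice_difference(2)[OF eq], of z] that ne
          by (simp add: space_kernel[OF S x] \<rho>_def)
      qed
      moreover have "(\<lambda>z. f (splice T S y z) - f (splice T S x z)) \<in> borel_measurable (J S x)"
        using integrable_kernel[OF S x] splice_bounded_measurable[OF S] fb x y
        by (intro borel_measurable_diff borel_measurable_integrable) auto
      ultimately show ?thesis
        using abs_integral_le[of _ "l j * \<rho>"] False by (simp add: B_def rate_def space_kernel[OF S x] mult.commute)
    qed
  qed
  have difference: "(\<integral>z. (f (splice T S y z) - f y) \<partial>(J S y)) - (\<integral>z. (f (splice T S x z) - f x) \<partial>(J S x)) =
      A S + B S - (f y - f x) * rate S x" if "S \<in> Pow T" for S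
  proof -
    have S: "S \<subseteq> T" using that by simp
    have "B S = (\<integral>z. f (splice T S y z) \<partial>(J S x)) - (\<integral>z. f (splice T S x z) \<partial>(J S x))"
      unfolding B_def
      by (intro Bochner_Integration.integral_diff integrable_kernel splice_bounded_measurable S x y fb)
    moreover have "(\<integral>z. (f (splice T S y z) - f y) \<partial>(J S x)) = (\<integral>z. f (splice T S y z) \<partial>(J S x)) - f y * rate S x"
      using finite_measure.finite_emeasure_space[OF finite_kernel[OF S x]]
        integrable_kernel[OF S x splice_bounded_measurable[OF S y fb]]
        finite_measure.integrable_const[OF finite_kernel[OF S x], of "f y"]
      by (simp add: rate_def space_kernel[OF S x])
    ultimately show ?thesis
      by (simp add: A_def integral_jump[OF S x fb] left_diff_distrib)
  qed
  have generator_diff: "generator T J f y - generator T J f x =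
      (\<Sum>S\<in>Pow T. A S) + (\<Sum>S\<in>Pow T. B S) - (f y - f x) * (\<Sum>S\<in>Pow T. rate S x)"
  proof -
    have "generator T J f y - generator T J f x = (\<Sum>S\<in>Pow T. A S + B S - (f y - f x) * rate S x)"
      unfolding generator_def sum_subtractf[symmetric] by (intro sum.cong refl difference)
    then show ?thesis by (simp add: sum.distrib sum_subtractf sum_distrib_left)
  qed
  define R where "R = (\<Sum>S\<in>Pow T. rate S x)"
  define Rj where "Rj = (\<Sum>S | S \<subseteq> T \<and> j \<in> S. rate S x)"
  have "R \<le> \<Lambda>" using bound[OF x] by (simp add: R_def)
  have "Rj + (\<Sum>S\<in>Pow T. if j \<in> S then 0 else rate S x) = R"
  proof -
    have "Rj = (\<Sum>S\<in>Pow T. if j \<in> S then rate S x else 0)"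
      unfolding Rj_def using finite_T by (intro sum.mono_neutral_cong_left) auto
    then show ?thesis by (simp add: R_def flip: sum.distrib) (intro sum.cong, auto)
  qed
  then have rest: "(\<Sum>S\<in>Pow T. if j \<in> S then 0 else rate S x) = R - Rj"
    by linarith
  have B_sum: "\<bar>\<Sum>S\<in>Pow T. B S\<bar> \<le> (R - Rj) * (l j * \<rho>)"
    unfolding rest[symmetric] sum_distrib_right by (rule order_trans[OF sum_abs sum_mono[OF B]])
  have A_sum: "\<bar>\<Sum>S\<in>Pow T. A S\<bar> \<le> (\<Sum>i\<in>T. l i * interaction T c i j) * \<rho>"
    unfolding interaction_sum[symmetric] sum_distrib_right by (rule order_trans[OF sum_abs sum_mono[OF A]])
  have "step \<Lambda> f y - step \<Lambda> f x =
      (f y - f x) + (generator T J f y - generator T J f x) / \<Lambda>"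
    by (simp add: step_def diff_divide_distrib)
  also have "\<dots> = (f y - f x) * (1 - R / \<Lambda>) + ((\<Sum>S\<in>Pow T. A S) + (\<Sum>S\<in>Pow T. B S)) / \<Lambda>"
    using \<Lambda> by (simp add: generator_diff R_def[symmetric] field_simps)
  \<comment> \<open>The choice of \<Lambda> makes \<open>1 - R / \<Lambda>\<close> nonnegative, so
    the loss term keeps its sign when absolute values are taken.\<close>
  also have "\<bar>\<dots>\<bar> \<le> \<bar>f y - f x\<bar> * (1 - R / \<Lambda>) + (\<bar>\<Sum>S\<in>Pow T. A S\<bar> + \<bar>\<Sum>S\<in>Pow T. B S\<bar>) / \<Lambda>"
    using \<Lambda> \<open>R \<le> \<Lambda>\<close>
    by (intro order_trans[OF abs_triangle_ineq] add_mono)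
       (auto simp: abs_mult abs_divide divide_right_mono)
  also have "\<dots> \<le> (l j * \<rho>) * (1 - R / \<Lambda>) +
      ((\<Sum>i\<in>T. l i * interaction T c i j) * \<rho> + (R - Rj) * (l j * \<rho>)) / \<Lambda>"
    using \<Lambda> \<open>R \<le> \<Lambda>\<close> Lip[OF x y eq ne] A_sum B_sum
    by (intro add_mono mult_right_mono divide_right_mono) (auto simp: \<rho>_def)
  \<comment> \<open>The loss \<open>R\<close> and the gain \<open>R - Rj\<close> nearly cancel; what
    survives is \<open>Rj\<close>, the rate at which site \<open>j\<close> is overwritten.\<close>
  also have "\<dots> = (l j * (1 - Rj / \<Lambda>) + (\<Sum>i\<in>T. l i * interaction T c i j) / \<Lambda>) * \<rho>"
    using \<Lambda> by (simp add: field_simps)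
  also have "\<dots> \<le> (l j * (1 - min_rate M T J / \<Lambda>) + (\<Sum>i\<in>T. l i * interaction T c i j) / \<Lambda>) * \<rho>"
    using \<Lambda> \<rho> min_rate_le[OF x j] l(1)[OF j]
    by (intro mult_right_mono add_mono mult_left_mono diff_mono divide_right_mono) (auto simp: Rj_def)
  also have "l j * (1 - min_rate M T J / \<Lambda>) + (\<Sum>i\<in>T. l i * interaction T c i j) / \<Lambda> =
      (\<Sum>i\<in>T. l i * step_matrix \<Lambda> i j)"
  proof -
    have "(\<Sum>i\<in>T. l i * mat_id i j) = l j"
      using finite_T j by (simp add: mat_id_def if_distrib[of "\<lambda>c. _ * c"] sum.delta cong: if_cong)
    moreover have "l i * step_matrix \<Lambda> i j =
        (l i * mat_id i j) * (1 - min_rate M T J / \<Lambda>) + l i * interaction T c i j / \<Lambda>" for i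
      by (simp add: step_matrix_def algebra_simps diff_divide_distrib)
    ultimately show ?thesis
      by (simp add: sum.distrib sum_divide_distrib flip: sum_distrib_right)
  qed
  finally show ?thesis by (simp add: \<rho>_def)
qed

section \<open>Iteration and Poisson summation\<close>

context
  fixes \<Lambda> :: real
  assumes \<Lambda>: "0 < \<Lambda>" and bound: "\<And>x. x \<in> space N \<Longrightarrow> (\<Sum>S\<in>Pow T. rate S x) \<le> \<Lambda>"
    and nonempty: "space N \<noteq> {}"
begin

text \<open>The infimum \<eta> lies below the update rate of site \<open>i\<close> at any one
  configuration, hence below \<Lambda>. One configuration must exist, since an infimum over the
  empty set carries no information.\<close>

lemma step_matrix_nonneg:
  assumes "i \<in> T" "j \<in> T"
  shows "0 \<le> step_matrix \<Lambda> i j"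
proof -
  obtain x where x: "x \<in> space N" using nonempty by blast
  have "min_rate M T J \<le> (\<Sum>S | S \<subseteq> T \<and> i \<in> S. rate S x)"
    by (rule min_rate_le[OF x assms(1)])
  also have "\<dots> \<le> (\<Sum>S\<in>Pow T. rate S x)"
    using finite_T by (intro sum_mono2) (auto simp: rate_nonneg)
  also have "\<dots> \<le> \<Lambda>" by (rule bound[OF x])
  finally have "0 \<le> (1 - min_rate M T J / \<Lambda>) * mat_id i j"
    using \<Lambda> by (simp add: mat_id_def)
  moreover have "0 \<le> interaction T c i j / \<Lambda>"
    using \<Lambda> interaction_nonneg[OF assms(2)] by simp
  ultimately show ?thesis
    by (simp add: step_matrix_def left_diff_distrib diff_divide_distrib add_divide_distrib)
qed

text \<open>The row vector \<open>l\<close> times the \<open>n\<close>-th power of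
  \<open>step_matrix \<Lambda>\<close>, read at entry \<open>j\<close>. The induction peels off the
  innermost step, replacing \<open>f\<close> by \<open>step \<Lambda> f\<close> and \<open>l\<close>
  by the row vector \<open>l'\<close>; both are therefore generalized, and \<open>l\<close> is any
  majorant of the coefficients.\<close>

lemma delta_step_iterate_le:
  assumes j: "j \<in> T" and f: "f \<in> C_Lip M d T"
    and l: "\<And>i. i \<in> T \<Longrightarrow> 0 \<le> l i" "\<And>i. i \<in> T \<Longrightarrow> delta M d T i f \<le> ereal (l i)"
  shows "delta M d T j ((step \<Lambda> ^^ n) f) \<le>
    ereal (\<Sum>i\<in>T. l i * (matrix_op T (step_matrix \<Lambda>) ^^ n) (\<lambda>i. mat_id i j) i)"
  using f l
proof (induction n arbitrary: f l)
  case 0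
  have "(\<Sum>i\<in>T. l i * mat_id i j) = l j"
    using finite_T j by (simp add: mat_id_def if_distrib[of "\<lambda>c. _ * c"] sum.delta cong: if_cong)
  with 0 j show ?case by simp
next
  case (Suc n)
  interpret step: bounded_operator "space N" "bounded_measurable N" "step \<Lambda>" 1
    by (intro bounded_operator_markov markov_operator_step \<Lambda> bound)
  define l' where "l' i = (\<Sum>k\<in>T. l k * step_matrix \<Lambda> k i)" for i
  let ?w = "(matrix_op T (step_matrix \<Lambda>) ^^ n) (\<lambda>i. mat_id i j)"
  have l'_nonneg: "0 \<le> l' i" if "i \<in> T" for i
    unfolding l'_def by (intro sum_nonneg mult_nonneg_nonneg Suc.prems step_matrix_nonneg that)
  have l': "delta M d T i (step \<Lambda> f) \<le> ereal (l' i)" if i: "i \<in> T" for i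
    by (rule iffD2[OF delta_le_iff[OF metric i l'_nonneg[OF i]]], unfold l'_def)
       (intro ballI impI, rule delta_step_le[OF \<Lambda> bound Suc.prems _ _ i])
  have "step \<Lambda> f \<in> C_Lip M d T"
    by (rule C_LipI[OF finite_T step.op_member l']) (use Suc.prems(1) in \<open>simp_all add: C_Lip_def\<close>)
  from Suc.IH[OF this l'_nonneg l']
  have "delta M d T j ((step \<Lambda> ^^ Suc n) f) \<le> ereal (\<Sum>i\<in>T. l' i * ?w i)"
    by (simp only: funpow_Suc_right comp_apply)
  \<comment> \<open>Associativity: the matrix moves from the row vector on its left to the column
    vector on its right.\<close>
  also have "(\<Sum>i\<in>T. l' i * ?w i) = (\<Sum>k\<in>T. l k * matrix_op T (step_matrix \<Lambda>) ?w k)"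
    by (simp add: l'_def matrix_op_def sum_distrib_left sum_distrib_right mult.assoc) (rule sum.swap)
  finally show ?case by simp
qed

lemma delta_semigroup_le_nonempty:
  assumes j: "j \<in> T" and f: "f \<in> C_Lip M d T" and t: "0 \<le> t"
    and l: "\<And>i. i \<in> T \<Longrightarrow> 0 \<le> l i" "\<And>i. i \<in> T \<Longrightarrow> delta M d T i f \<le> ereal (l i)"
  shows "delta M d T j (op_exp (generator T J) t f) \<le>
    ereal (\<Sum>i\<in>T. l i * mat_exp T (\<lambda>k l. - t * (min_rate M T J * mat_id k l - interaction T c k l)) i j)"
proof -
  interpret step: bounded_operator "space N" "bounded_measurable N" "step \<Lambda>" 1
    by (intro bounded_operator_markov markov_operator_step \<Lambda> bound)
  interpret matrix: bounded_operator T UNIV "matrix_op T (step_matrix \<Lambda>)"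
    "\<Sum>i\<in>T. \<Sum>k\<in>T. \<bar>step_matrix \<Lambda> i k\<bar>"
    by (rule bounded_operator_matrix_op[OF finite_T])
  have fb: "f \<in> bounded_measurable N" using f by (simp add: C_Lip_def)
  define r where "r = \<Lambda> * t"
  have r: "0 \<le> r" using \<Lambda> t by (simp add: r_def)
  define e where "e = (\<lambda>i. mat_id i j)"
  define v where "v n = (\<Sum>i\<in>T. l i * (matrix_op T (step_matrix \<Lambda>) ^^ n) e i)" for n
  define W where "W = (\<Sum>i\<in>T. l i * op_exp (matrix_op T (step_matrix \<Lambda>)) r e i)"
  have v_nonneg: "0 \<le> v n" for n
    unfolding v_def
    by (intro sum_nonneg mult_nonneg_nonneg l(1) matrix_op_iterate_nonneg step_matrix_nonneg)
       (auto simp: e_def mat_id_def)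
  have "(\<lambda>n. \<Sum>i\<in>T. l i * (r ^ n / fact n * (matrix_op T (step_matrix \<Lambda>) ^^ n) e i)) sums W"
    unfolding W_def by (intro sums_sum sums_mult matrix.op_exp_sums) auto
  then have v_sums: "(\<lambda>n. r ^ n / fact n * v n) sums W"
    by (simp add: v_def sum_distrib_left mult_ac)
  have W_nonneg: "0 \<le> W"
    unfolding sums_unique[OF v_sums] using r v_nonneg sums_summable[OF v_sums]
    by (intro suminf_nonneg) auto
  have bound_eq: "(\<Sum>i\<in>T. l i * mat_exp T (\<lambda>k l. - t * (min_rate M T J * mat_id k l - interaction T c k l)) i j) =
    exp (- r) * W"
  proof -
    have "mat_exp T (\<lambda>k l. - t * (min_rate M T J * mat_id k l - interaction T c k l)) i j =
        exp (- r) * op_exp (matrix_op T (step_matrix \<Lambda>)) r e i" if "i \<in> T" for i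
      unfolding e_def
      by (rule mat_exp_uniformization[OF finite_T _ that])
         (use \<Lambda> in \<open>simp add: r_def step_matrix_def field_simps\<close>)
    then show ?thesis by (simp add: W_def sum_distrib_left mult_ac)
  qed
  \<comment> \<open>Positivity is read off the Poisson form; the exponent of the original matrix
    exponential may have negative diagonal entries.\<close>
  have bound_nonneg: "0 \<le> exp (- r) * W" using W_nonneg by simp
  show ?thesis
    unfolding bound_eq delta_le_iff[OF metric j bound_nonneg]
  proof (intro ballI impI)
    fix x y assume x: "x \<in> space N" and y: "y \<in> space N"
      and eq: "\<forall>k\<in>T. k \<noteq> j \<longrightarrow> x k = y k" and ne: "x j \<noteq> y j"
    define \<rho> where "\<rho> = d (y j) (x j)"
    let ?b = "\<lambda>n x. r ^ n / fact n * (step \<Lambda> ^^ n) f x"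
    \<comment> \<open>The weights \<open>r ^ n / fact n\<close> are nonnegative because time is, so
      the bound for each iterate survives summation.\<close>
    have term_le: "\<bar>?b n y - ?b n x\<bar> \<le> \<rho> * (r ^ n / fact n * v n)" for n
    proof -
      have "\<bar>(step \<Lambda> ^^ n) f y - (step \<Lambda> ^^ n) f x\<bar> \<le> v n * \<rho>"
        using delta_step_iterate_le[OF j f l, of n] x y eq ne
        by (simp add: delta_le_iff[OF metric j v_nonneg[unfolded v_def e_def]] v_def e_def \<rho>_def)
      then have "r ^ n / fact n * \<bar>(step \<Lambda> ^^ n) f y - (step \<Lambda> ^^ n) f x\<bar> \<le> r ^ n / fact n * (v n * \<rho>)"
        using r by (intro mult_left_mono) auto
      moreover have "\<bar>?b n y - ?b n x\<bar> = r ^ n / fact n * \<bar>(step \<Lambda> ^^ n) f y - (step \<Lambda> ^^ n) f x\<bar>"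
        unfolding right_diff_distrib[symmetric] using r by (simp add: abs_mult)
      ultimately show ?thesis by (simp add: mult_ac)
    qed
    have b_sums: "(\<lambda>n. ?b n y - ?b n x) sums (op_exp (step \<Lambda>) r f y - op_exp (step \<Lambda>) r f x)"
      by (intro sums_diff step.op_exp_sums fb x y)
    have w_sums: "(\<lambda>n. \<rho> * (r ^ n / fact n * v n)) sums (\<rho> * W)"
      by (rule sums_mult[OF v_sums])
    have "norm (\<Sum>n. ?b n y - ?b n x) \<le> (\<Sum>n. \<rho> * (r ^ n / fact n * v n))"
      by (rule norm_suminf_le) (simp only: real_norm_def term_le, rule sums_summable[OF w_sums])
    then have "\<bar>op_exp (step \<Lambda>) r f y - op_exp (step \<Lambda>) r f x\<bar> \<le> \<rho> * W"
      by (simp only: sums_unique[OF b_sums, symmetric] sums_unique[OF w_sums, symmetric] real_norm_def)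
    then have "exp (- r) * \<bar>op_exp (step \<Lambda>) r f y - op_exp (step \<Lambda>) r f x\<bar> \<le> exp (- r) * (\<rho> * W)"
      by (intro mult_left_mono) auto
    then show "\<bar>op_exp (generator T J) t f y - op_exp (generator T J) t f x\<bar> \<le> exp (- r) * W * d (y j) (x j)"
      by (simp add: op_exp_generator[OF \<Lambda> bound fb] x y r_def[symmetric] \<rho>_def[symmetric]
          abs_mult mult_ac flip: right_diff_distrib)
  qed
qed

end

theorem delta_semigroup_le:
  assumes f: "f \<in> C_Lip M d T" and t: "0 \<le> t" and j: "j \<in> T"
  shows "delta M d T j (op_exp (generator T J) t f) \<le>
    (\<Sum>i\<in>T. delta M d T i f *
       ereal (mat_exp T (\<lambda>k l. - t * (min_rate M T J * mat_id k l - interaction T c k l)) i j))"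
proof (cases "space N = {}")
  \<comment> \<open>Without configurations \<eta> has no controlled value, but all Lipschitz
    coefficients are 0 and both sides vanish.\<close>
  case True
  then show ?thesis by (simp add: delta_empty_space)
next
  case False
  obtain \<Lambda> where \<Lambda>: "0 < \<Lambda>" and bound: "\<And>x. x \<in> space N \<Longrightarrow> (\<Sum>S\<in>Pow T. rate S x) \<le> \<Lambda>"
    using rate_bound by blast
  obtain l where l: "\<And>i. i \<in> T \<Longrightarrow> 0 \<le> l i" "\<And>i. i \<in> T \<Longrightarrow> delta M d T i f = ereal (l i)"
    using C_Lip_obtain_constants[OF finite_T f] by blast
  show ?thesis
    using delta_semigroup_le_nonempty[OF \<Lambda> bound False j f t l(1)] l(2) by simp
qed

theorem semigroup_C_Lip:
  assumes f: "f \<in> C_Lip M d T" and t: "0 \<le> t"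
  shows "op_exp (generator T J) t f \<in> C_Lip M d T"
proof -
  obtain D where "bounded_operator (space N) (bounded_measurable N) (generator T J) D"
    using bounded_operator_generator by blast
  then interpret bounded_operator "space N" "bounded_measurable N" "generator T J" D .
  obtain l where l: "\<And>i. i \<in> T \<Longrightarrow> 0 \<le> l i" "\<And>i. i \<in> T \<Longrightarrow> delta M d T i f = ereal (l i)"
    using C_Lip_obtain_constants[OF finite_T f] by blast
  have "delta M d T j (op_exp (generator T J) t f) < \<infinity>" if j: "j \<in> T" for j
    using delta_semigroup_le[OF f t j] l(2) by (auto intro: le_less_trans)
  with f show ?thesis
    by (simp add: C_Lip_iff[OF finite_T] op_exp_member)
qed

end

text \<open>The first conjunct identifies the pointwise series \<open>op_exp\<close> with the
  exponential of the generator in the supremum norm.\<close>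

theorem theorem3p1:
  fixes M :: "'a measure" and d :: "'a \<Rightarrow> 'a \<Rightarrow> real" and T :: "'i set"
    and J :: "'i set \<Rightarrow> ('i \<Rightarrow> 'a) \<Rightarrow> ('i \<Rightarrow> 'a) measure"
    and c :: "'i set \<Rightarrow> 'i \<Rightarrow> real"
  assumes space: "polish_setting M d \<or> trivial_metric_setting M d"
    and finite: "finite T"
    and kernel: "\<And>S. S \<subseteq> T \<Longrightarrow> bounded_kernel (config M T) (config M S) (J S)"
    and const: "\<And>S j. S \<subseteq> T \<Longrightarrow> j \<in> T \<Longrightarrow> optimal_const M d T S (J S) j (c S j)"
  shows
    "(\<forall>t\<ge>0. \<forall>f\<in>bounded_measurable (config M T).
        uniform_limit (space (config M T)) (op_exp_partial (generator T J) t f)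
          (op_exp (generator T J) t f) sequentially) \<and>
     markov_semigroup (config M T) (op_exp (generator T J)) \<and>
     (\<forall>t\<ge>0. \<forall>f\<in>C_Lip M d T. op_exp (generator T J) t f \<in> C_Lip M d T) \<and>
     (\<forall>f\<in>C_Lip M d T. \<forall>t\<ge>0. \<forall>j\<in>T.
        delta M d T j (op_exp (generator T J) t f) \<le>
          (\<Sum>i\<in>T. delta M d T i f *
             ereal (mat_exp T
               (\<lambda>k l. - t * (min_rate M T J * mat_id k l - interaction T c k l)) i j)))"
proof -
  interpret lipschitz_jump_process M T J d c
    using finite kernel const positive_off_diagonal_setting[OF space]
    by unfold_locales (auto simp: optimal_const_def)
  obtain D where "bounded_operator (space N) (bounded_measurable N) (generator T J) D"
    using bounded_operator_generator by blast
  then interpret bounded_operator "space N" "bounded_measurable N" "generator T J" D .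
  show ?thesis
    using uniform_limit_partial markov_semigroup_generator semigroup_C_Lip delta_semigroup_le by blast
qed

end
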